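(* Given a fractional laminar cut family $\mathcal{C}$ feasible for the MCP on a graph $G$ with integral edge capacities $c_e$, the algorithm Round-2 produces an integral family of cuts $\mathcal{A}$ that is feasible for the MCP on $G$ with edge capacities $c_e+3$.
   Context: MCP (multiway cut packing): an undirected graph $G=(V,E)$ with positive integral edge capacities $c_e$, and $k$ sets of terminals $S_1,\dots,S_k$ (commodities); each terminal $i$ resides at a vertex $r_i\in V$, and distinct terminals of the same commodity reside at different vertices. A cut is a set $C$ with $\emptyset\subsetneq C\subsetneq V$; $\delta(C)$ is the set of edges with exactly one endpoint in $C$. Two cuts $C_1,C_2$ cross if $C_1\cap C_2$, $C_1\setminus C_2$, $C_2\setminus C_1$ are all non-empty. A collection of cuts is laminar if no two of its members cross. A fractional laminar cut family $\mathcal{C}$ for a terminal set $T$ with weight function $w$ is a laminar collection of cuts, each cut being associated with a unique terminal of $T$ (the same vertex set may occur several times), such that, writing $\mathcal{C}_i$ for the cuts associated with $i$, every $C\in\mathcal{C}_i$ contains $r_i$, and $\sum_{C\in\mathcal{C}_i}w(C)=1$ for every $i\in T$. Its load on $e$ is $\ell_e^{\mathcal{C}}=\sum_{C\in\mathcal{C}:\,e\in\delta(C)}w(C)$. The family is feasible for the MCP with edge capacities $c'_e$ if (1) $T=\bigcup_{a\in[k]}S_a$; (2) for all $a\in[k]$ and $i\ne j$ in $S_a$, either $r_j\notin\bigcup_{C\in\mathcal{C}_i}C$ or $r_i\notin\bigcup_{C\in\mathcal{C}_j}C$; (3) $\ell_e^{\mathcal{C}}\le c'_e$ for every $e\in E$.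 An integral family $\mathcal{A}=\{A_i\}_{i\in T}$ (one cut per terminal in $T=\bigcup_a S_a$) is feasible for the MCP with edge capacities $c'_e$ if $r_i\in A_i$ for every $i\in T$; for all $a\in[k]$ and $i\ne j$ in $S_a$, either $r_j\notin A_i$ or $r_i\notin A_j$; and $\ell_e^{\mathcal{A}}=|\{i\in T: e\in\delta(A_i)\}|\le c'_e$ for every $e\in E$. During the algorithm $\ell_e^{\mathcal{A}}$ counts the cuts currently in $\mathcal{A}$. Notation (always for the current $\mathcal{C}$): $K_v$ is the set of cuts in $\mathcal{C}$ containing $v$; the depth of $v$ is $\sum_{C\in K_v}w(C)$; the depth of a terminal is that of its vertex. $K_v^1$ is the set of innermost cuts of $K_v$ of total weight exactly $1$: if $K_v=\{L_1\subseteq\cdots\subseteq L_l\}$ and $\sum_{a<l'}w(L_a)<1\le\sum_{a\le l'}w(L_a)$, it consists of $L_1,\dots,L_{l'}$, with $L_{l'}$ taken only to the extent $1-\sum_{a<l'}w(L_a)$ of its weight (a cut may be split into two copies with weights summing to the original weight). $O_i$ is the largest (outermost) cut in $\mathcal{C}_i$. Terminal $i$ dominates $j$ in the cut-inclusion order, $i>_{CI}j$, if $O_i\subset O_j$ (if $O_i=O_j$ ties are broken arbitrarily but consistently). Inclusion invariant: whenever $i>_{CI}j$, $C_i\in\mathcal{C}_i$, $C_j\in\mathcal{C}_j$ and $r_i,r_j\in C_i\cap C_j$, we have $C_i\subseteq C_j$. Algorithm Round-2. Input: $G$, $c_e$, $T$ and the fractional laminar cut family $\mathcal{C}$. Output: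 a collection $\mathcal{A}$ of cuts, one for each terminal in $T$. (1) Preprocess $\mathcal{C}$, by reassigning cuts among terminals, so that it satisfies the inclusion invariant (each new $O_i$ being the same as or a subset of the original one). (2) Set $T'=T$, $\mathcal{A}=\emptyset$, $Y=Z=\emptyset$, $M(v)=\{v\}$ for all $v\in V$ (meta-node of $v$). (3) While there are terminals in $T'$: (a) among the unassigned terminals of maximum depth let $i\in T'$ be one that is undominated in the cut-inclusion order; let $E_i=Y\cap\delta(M(r_i))$. (b) If $E_i=\emptyset$, let $A_i=M(r_i)$. (c) If $E_i\ne\emptyset$, let $U_i$ be the set of endpoints of edges of $E_i$ lying in $M(r_i)$. If $r_i\in U_i$, abort and return error. Otherwise let $u_i$ be the vertex of $U_i$ that entered $M(r_i)$ first during the execution, and set $A_i$ to be the meta-node of $r_i$ just prior to the iteration where $M(u_i)$ becomes equal to $M(r_i)$. (d) Add $A_i$ to $\mathcal{A}$; remove $\mathcal{C}_i$ from $\mathcal{C}$ and $i$ from $T'$; for every $j\in T'$ and $C\in K_{r_i}^1\cap\mathcal{C}_j$ (with $K_{r_i}^1$ taken before this removal) replace $C$ by $C\setminus M(r_i)$. (e) If for some edge $e$, $\ell_e^{\mathcal{A}}=c_e+2$ and $\ell_e^{\mathcal{C}}>0$, add $e$ to $Y$. If there is an edge $e=(u,v)$ with $\ell_e^{\mathcal{C}}=0$, merge $M(u)$ and $M(v)$. Add all edges $e$ with $\ell_e^{\mathcal{C}}=0$ to $Z$ and remove them from $Y$. (f) Recompute the depths of vertices and terminals. Ownership of cuts by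 terminals remains unchanged as cuts are modified; containment relations between cuts, and hence the inclusion invariant, continue to hold throughout, and throughout the execution $\mathcal{C}$ is kept a fractional laminar family for the terminals $T'$. *)

theory Defs
  imports Complex_Main
begin

record ('v, 't) mcp =
  verts :: "'v set"
  edges :: "'v set set"
  cap :: "'v set \<Rightarrow> nat"
  ncomm :: nat
  comm :: "nat \<Rightarrow> 't set"
  loc :: "'t \<Rightarrow> 'v"

definition mcp_instance :: "('v, 't) mcp \<Rightarrow> bool" where
  "mcp_instance P \<longleftrightarrow>
     finite (verts P) \<and>
     (\<forall>e\<in>edges P. \<exists>u\<in>verts P. \<exists>v\<in>verts P. u \<noteq> v \<and> e = {u, v}) \<and>
     (\<forall>e\<in>edges P. 0 < cap P e) \<and>
     (\<forall>a\<in>{1..ncomm P}. \<forall>i\<in>comm P a. loc P i \<in> verts P) \<and>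
     (\<forall>a\<in>{1..ncomm P}. inj_on (loc P) (comm P a))"

definition terminals :: "('v, 't) mcp \<Rightarrow> 't set" where
  "terminals P = (\<Union>a\<in>{1..ncomm P}. comm P a)"

definition is_cut :: "('v, 't) mcp \<Rightarrow> 'v set \<Rightarrow> bool" where
  "is_cut P C \<longleftrightarrow> C \<noteq> {} \<and> C \<subset> verts P"

definition delta :: "('v, 't) mcp \<Rightarrow> 'v set \<Rightarrow> 'v set set" where
  "delta P C = {e \<in> edges P. card (e \<inter> C) = 1}"

definition crosses :: "'v set \<Rightarrow> 'v set \<Rightarrow> bool" where
  "crosses C D \<longleftrightarrow> C \<inter> D \<noteq> {} \<and> C - D \<noteq> {} \<and> D - C \<noteq> {}"

text \<open>
  A family is given by its weights: \<open>F i C\<close> is the total weight of the copies of the vertex set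
  \<open>C\<close> that are associated with the terminal \<open>i\<close>, so copies of one set with the same owner are
  pooled, while copies with different owners stay apart. Weight \<open>0\<close> means that \<open>C\<close> is not a
  cut of \<open>i\<close>.
\<close>

type_synonym ('v, 't) family = "'t \<Rightarrow> 'v set \<Rightarrow> real"

definition cuts_of :: "('v, 't) family \<Rightarrow> 't \<Rightarrow> 'v set set" where
  "cuts_of F i = {C. 0 < F i C}"

definition members :: "('v, 't) family \<Rightarrow> ('t \<times> 'v set) set" where
  "members F = {(i, C). C \<in> cuts_of F i}"

definition frac_laminar_family :: "('v, 't) mcp \<Rightarrow> 't set \<Rightarrow> ('v, 't) family \<Rightarrow> bool" where
  "frac_laminar_family P T F \<longleftrightarrow>
     (\<forall>i C. 0 \<le> F i C) \<and>
     (\<forall>i C. i \<notin> T \<longrightarrow> F i C = 0) \<and>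
     (\<forall>(i, C)\<in>members F. is_cut P C \<and> loc P i \<in> C) \<and>
     (\<forall>(i, C)\<in>members F. \<forall>(j, D)\<in>members F. \<not> crosses C D) \<and>
     (\<forall>i\<in>T. (\<Sum>C\<in>cuts_of F i. F i C) = 1)"

definition frac_load :: "('v, 't) mcp \<Rightarrow> ('v, 't) family \<Rightarrow> 'v set \<Rightarrow> real" where
  "frac_load P F e = (\<Sum>(i, C) \<in> {(i, C) \<in> members F. e \<in> delta P C}. F i C)"

definition frac_feasible ::
  "('v, 't) mcp \<Rightarrow> ('v set \<Rightarrow> nat) \<Rightarrow> ('v, 't) family \<Rightarrow> bool" where
  "frac_feasible P c F \<longleftrightarrow>
     frac_laminar_family P (terminals P) F \<and>
     (\<forall>a\<in>{1..ncomm P}. \<forall>i\<in>comm P a. \<forall>j\<in>comm P a. i \<noteq> j \<longrightarrow>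
        loc P j \<notin> \<Union>(cuts_of F i) \<or> loc P i \<notin> \<Union>(cuts_of F j)) \<and>
     (\<forall>e\<in>edges P. frac_load P F e \<le> real (c e))"

definition int_load :: "('v, 't) mcp \<Rightarrow> ('t \<rightharpoonup> 'v set) \<Rightarrow> 'v set \<Rightarrow> nat" where
  "int_load P A e = card {i \<in> dom A. e \<in> delta P (the (A i))}"

definition int_feasible ::
  "('v, 't) mcp \<Rightarrow> ('v set \<Rightarrow> nat) \<Rightarrow> ('t \<rightharpoonup> 'v set) \<Rightarrow> bool" where
  "int_feasible P c A \<longleftrightarrow>
     dom A = terminals P \<and>
     (\<forall>i\<in>terminals P. is_cut P (the (A i)) \<and> loc P i \<in> the (A i)) \<and>
     (\<forall>a\<in>{1..ncomm P}. \<forall>i\<in>comm P a. \<forall>j\<in>comm P a. i \<noteq> j \<longrightarrow>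
        loc P j \<notin> the (A i) \<or> loc P i \<notin> the (A j)) \<and>
     (\<forall>e\<in>edges P. int_load P A e \<le> c e)"

definition cuts_at :: "('v, 't) family \<Rightarrow> 'v \<Rightarrow> ('t \<times> 'v set) set" where
  "cuts_at F v = {(i, C) \<in> members F. v \<in> C}"

definition depth :: "('v, 't) family \<Rightarrow> 'v \<Rightarrow> real" where
  "depth F v = (\<Sum>(i, C) \<in> cuts_at F v. F i C)"

definition outermost :: "('v, 't) family \<Rightarrow> 't \<Rightarrow> 'v set" where
  "outermost F i = (GREATEST C. C \<in> cuts_of F i)"

text \<open>
  \<open>tie\<close> is the arbitrary strict linear order on terminals used whenever outermost cuts coincide.
\<close>

definition dominates :: "('v, 't) family \<Rightarrow> 't rel \<Rightarrow> 't \<Rightarrow> 't \<Rightarrow> bool" where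
  "dominates F tie i j \<longleftrightarrow>
     outermost F i \<subset> outermost F j \<or> outermost F i = outermost F j \<and> (i, j) \<in> tie"

definition inclusion_invariant ::
  "('v, 't) mcp \<Rightarrow> 't set \<Rightarrow> 't rel \<Rightarrow> ('v, 't) family \<Rightarrow> bool" where
  "inclusion_invariant P T tie F \<longleftrightarrow>
     (\<forall>i\<in>T. \<forall>j\<in>T. dominates F tie i j \<longrightarrow>
        (\<forall>C\<in>cuts_of F i. \<forall>D\<in>cuts_of F j. {loc P i, loc P j} \<subseteq> C \<inter> D \<longrightarrow> C \<subseteq> D))"

text \<open>
  The cuts containing \<open>v\<close> are listed from the inside out. Equal vertex sets with different owners
  are listed with the dominating owner first: if the dominated owner's copy were shrunk
  first, the containment between the two copies, and with it the inclusion invariant, could be lost.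
\<close>

definition inner :: "('v, 't) family \<Rightarrow> 't rel \<Rightarrow> 't \<times> 'v set \<Rightarrow> 't \<times> 'v set \<Rightarrow> bool" where
  "inner F tie = (\<lambda>(i, C) (j, D). C \<subset> D \<or> C = D \<and> dominates F tie i j)"

text \<open>
  Listing the cuts around \<open>v\<close> by \<open>inner\<close>, the innermost weight \<open>1\<close> takes cuts completely until
  the total would exceed \<open>1\<close>; the cut reached then contributes the missing amount and cuts further
  out contribute \<open>0\<close>. \<open>innermost1 F tie v j D\<close> is the weight taken from the cut \<open>D\<close> of \<open>j\<close>.
\<close>

definition innermost1 :: "('v, 't) family \<Rightarrow> 't rel \<Rightarrow> 'v \<Rightarrow> 't \<Rightarrow> 'v set \<Rightarrow> real" where
  "innermost1 F tie v j D =
     (if (j, D) \<in> cuts_at F v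
      then max 0 (min (F j D)
             (1 - (\<Sum>(i, C) \<in> {p \<in> cuts_at F v. inner F tie p (j, D)}. F i C)))
      else 0)"

text \<open>
  Reassignment keeps the total weight of every vertex set; cuts may be split on the way.
\<close>

definition preprocessed ::
  "('v, 't) mcp \<Rightarrow> 't rel \<Rightarrow> ('v, 't) family \<Rightarrow> ('v, 't) family \<Rightarrow> bool" where
  "preprocessed P tie F F' \<longleftrightarrow>
     frac_laminar_family P (terminals P) F' \<and>
     (\<forall>C. (\<Sum>i\<in>terminals P. F' i C) = (\<Sum>i\<in>terminals P. F i C)) \<and>
     (\<forall>i\<in>terminals P. outermost F' i \<subseteq> outermost F i) \<and>
     inclusion_invariant P (terminals P) tie F'"

text \<open>
  \<open>hist s ! t\<close> maps each vertex to its meta-node after \<open>t\<close> iterations.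
\<close>

record ('v, 't) state =
  fam :: "('v, 't) family"
  todo :: "'t set"
  cuts :: "'t \<rightharpoonup> 'v set"
  Yset :: "'v set set"
  Zset :: "'v set set"
  hist :: "('v \<Rightarrow> 'v set) list"

definition meta :: "('v, 't) state \<Rightarrow> 'v \<Rightarrow> 'v set" where
  "meta s = last (hist s)"

definition initial :: "('v, 't) mcp \<Rightarrow> ('v, 't) family \<Rightarrow> ('v, 't) state" where
  "initial P F = \<lparr>fam = F, todo = terminals P, cuts = Map.empty, Yset = {}, Zset = {},
                  hist = [\<lambda>v. {v}]\<rparr>"

definition selectable :: "('v, 't) mcp \<Rightarrow> 't rel \<Rightarrow> ('v, 't) state \<Rightarrow> 't \<Rightarrow> bool" where
  "selectable P tie s i \<longleftrightarrow>
     (let T1 = {j \<in> todo s. \<forall>k\<in>todo s. depth (fam s) (loc P k) \<le> depth (fam s) (loc P j)}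
      in i \<in> T1 \<and> (\<forall>j\<in>T1. \<not> dominates (fam s) tie j i))"

definition conflict_edges :: "('v, 't) mcp \<Rightarrow> ('v, 't) state \<Rightarrow> 't \<Rightarrow> 'v set set" where
  "conflict_edges P s i = Yset s \<inter> delta P (meta s (loc P i))"

definition conflict_verts :: "('v, 't) mcp \<Rightarrow> ('v, 't) state \<Rightarrow> 't \<Rightarrow> 'v set" where
  "conflict_verts P s i = \<Union>(conflict_edges P s i) \<inter> meta s (loc P i)"

definition entry_time :: "('v, 't) mcp \<Rightarrow> ('v, 't) state \<Rightarrow> 't \<Rightarrow> 'v \<Rightarrow> nat" where
  "entry_time P s i u = (LEAST t. t < length (hist s) \<and> u \<in> (hist s ! t) (loc P i))"

definition aborts :: "('v, 't) mcp \<Rightarrow> ('v, 't) state \<Rightarrow> 't \<Rightarrow> bool" where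
  "aborts P s i \<longleftrightarrow> conflict_edges P s i \<noteq> {} \<and> loc P i \<in> conflict_verts P s i"

definition chosen_cut :: "('v, 't) mcp \<Rightarrow> ('v, 't) state \<Rightarrow> 't \<Rightarrow> 'v set \<Rightarrow> bool" where
  "chosen_cut P s i A \<longleftrightarrow>
     (if conflict_edges P s i = {} then A = meta s (loc P i)
      else \<exists>u\<in>conflict_verts P s i.
             (\<forall>u'\<in>conflict_verts P s i. entry_time P s i u \<le> entry_time P s i u') \<and>
             A = (hist s ! (entry_time P s i u - 1)) (loc P i))"

definition shrink ::
  "('v, 't) mcp \<Rightarrow> 't rel \<Rightarrow> ('v, 't) state \<Rightarrow> 't \<Rightarrow> ('v, 't) family" where
  "shrink P tie s i = (\<lambda>j D.
     let F = fam s; K1 = innermost1 F tie (loc P i) in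
     if j \<in> todo s - {i}
     then F j D - K1 j D + (\<Sum>C \<in> {C \<in> cuts_of F j. C - meta s (loc P i) = D}. K1 j C)
     else 0)"

text \<open>
  All edges of load \<open>0\<close> are contracted in one iteration, so the new meta-nodes are reachability
  classes.
\<close>

definition merge ::
  "('v, 't) mcp \<Rightarrow> ('v, 't) family \<Rightarrow> ('v \<Rightarrow> 'v set) \<Rightarrow> 'v \<Rightarrow> 'v set" where
  "merge P F M v =
     {(x, y). y \<in> M x \<or> {x, y} \<in> edges P \<and> frac_load P F {x, y} = 0}\<^sup>* `` {v}"

definition iterate ::
  "('v, 't) mcp \<Rightarrow> 't rel \<Rightarrow> ('v, 't) state \<Rightarrow> 't \<Rightarrow> 'v set \<Rightarrow> ('v, 't) state" where
  "iterate P tie s i A =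
     (let F' = shrink P tie s i;
          A' = (cuts s)(i \<mapsto> A);
          Z0 = {e \<in> edges P. frac_load P F' e = 0}
      in \<lparr>fam = F', todo = todo s - {i}, cuts = A',
          Yset = (Yset s \<union> {e \<in> edges P. int_load P A' e = cap P e + 2 \<and> frac_load P F' e > 0}) - Z0,
          Zset = Zset s \<union> Z0,
          hist = hist s @ [merge P F' (meta s)]\<rparr>)"

datatype ('v, 't) config =
  Input "('v, 't) family" | Loop "('v, 't) state" | Error | Output "'t \<rightharpoonup> 'v set"

inductive round2_step ::
  "('v, 't) mcp \<Rightarrow> 't rel \<Rightarrow> ('v, 't) config \<Rightarrow> ('v, 't) config \<Rightarrow> bool"
  for P :: "('v, 't) mcp" and tie :: "'t rel"
where
  start: "preprocessed P tie F F' \<Longrightarrow> round2_step P tie (Input F) (Loop (initial P F'))"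
| error: "selectable P tie s i \<Longrightarrow> aborts P s i \<Longrightarrow> round2_step P tie (Loop s) Error"
| iteration: "selectable P tie s i \<Longrightarrow> \<not> aborts P s i \<Longrightarrow> chosen_cut P s i A \<Longrightarrow>
    round2_step P tie (Loop s) (Loop (iterate P tie s i A))"
| finish: "todo s = {} \<Longrightarrow> round2_step P tie (Loop s) (Output (cuts s))"

text \<open>
  Total correctness for a nondeterministic run: no infinite execution, and every execution that
  cannot be continued has ended with an output satisfying \<open>Q\<close>. In particular no execution reaches
  \<open>Error\<close> or gets stuck.
\<close>

definition round2_produces ::
  "('v, 't) mcp \<Rightarrow> 't rel \<Rightarrow> ('v, 't) family \<Rightarrow> (('t \<rightharpoonup> 'v set) \<Rightarrow> bool) \<Rightarrow> bool" where
  "round2_produces P tie F Q \<longleftrightarrow>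
     \<not> (\<exists>g. g 0 = Input F \<and> (\<forall>n::nat. round2_step P tie (g n) (g (Suc n)))) \<and>
     (\<forall>x. (round2_step P tie)\<^sup>*\<^sup>* (Input F) x \<and> \<not> (\<exists>y. round2_step P tie x y) \<longrightarrow>
        (\<exists>A. x = Output A \<and> Q A))"

end

theory Submission
  imports Defs "HOL-Analysis.Function_Topology"
begin

text \<open>
  Take an edge \<open>uw\<close> and let the selected terminal \<open>i\<close> lie in the meta-node of \<open>u\<close>. As \<open>i\<close> has
  maximal depth, either a full unit of cuts separates \<open>u\<close> from \<open>w\<close>, and the fractional load drops by
  \<open>1\<close>, or afterwards every cut around \<open>u\<close> contains \<open>w\<close> and the fractional load is at most \<open>1\<close>. In
  the first phase the total of both loads therefore never grows. Once the edge is nested, the steps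
  touching it alternate between its two ends.

  Shrinking never changes dominance. A terminal other than \<open>i\<close> that owns part of the innermost
  unit of cuts around \<open>i\<close> dominates \<open>i\<close>, while \<open>i\<close> dominates all remaining terminals in its
  meta-node. At a nested edge the selected terminal owns a cut separating the ends; this cut was
  created by the preceding step at the edge, so the selected terminal dominates the one selected
  there, and by transitivity also the one selected two steps before, at its own end. It therefore
  was not in the meta-node of that end at that time. Every edge of \<open>Y\<close> has seen three
  such steps. So the algorithm does not abort, and an edge that has been contracted (with
  integral load at most \<open>c\<^sub>e + 2\<close>) is cut at most once more.

  The preprocessed family maximises a linear functional that rewards large cuts of dominated
  terminals, over a compact set of reassignments: a violation of the inclusion invariant could be
  swapped away with profit.
\<close>

section \<open>Fractional laminar families\<close>

text \<open>Induction removing the \<open>R\<close>-largest element \<open>m\<close>: by totality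
  all others precede it, and their own initial segments do not involve \<open>m\<close>. What is
  missing to 1 after them is taken from \<open>m\<close>, as far as \<open>W m\<close>
  allows.\<close>

lemma sum_take_inner_weight:
  fixes W :: "'a \<Rightarrow> real"
  assumes "finite K" "\<And>p. p \<in> K \<Longrightarrow> 0 \<le> W p"
    and "asymp_on K R" "transp_on K R" "totalp_on K R"
  shows "(\<Sum>p\<in>K. max 0 (min (W p) (1 - (\<Sum>q\<in>{q \<in> K. R q p}. W q)))) = min 1 (sum W K)"
  using assms
proof (induction "card K" arbitrary: K)
  case 0
  then show ?case by simp
next
  case (Suc n)
  then have "K \<noteq> {}" by auto
  then obtain m where m: "m \<in> K" "\<And>x. x \<in> K \<Longrightarrow> x \<noteq> m \<Longrightarrow> \<not> R m x"
    using Finite_Set.bex_max_element[OF Suc.prems(1,3,4)] by blast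
  let ?K = "K - {m}"
  have R: "R x m" if "x \<in> ?K" for x
    using Suc.prems(5) m that by (auto simp: totalp_on_def)
  have below_m: "{q \<in> K. R q m} = ?K"
    using R Suc.prems(3) m(1) by (auto simp: asymp_on_def)
  have below: "{q \<in> K. R q p} = {q \<in> ?K. R q p}" if "p \<in> ?K" for p
    using m that by auto
  have IH: "(\<Sum>p\<in>?K. max 0 (min (W p) (1 - (\<Sum>q\<in>{q \<in> ?K. R q p}. W q)))) = min 1 (sum W ?K)"
  proof (rule Suc.hyps(1))
    show "n = card ?K" using Suc.hyps(2) m(1) Suc.prems(1) by simp
  qed (use Suc.prems in \<open>auto intro: asymp_on_subset transp_on_subset totalp_on_subset\<close>)
  have "sum W K = W m + sum W ?K"
    using Suc.prems(1) m(1) by (rule sum.remove)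
  moreover have "(\<Sum>p\<in>K. max 0 (min (W p) (1 - (\<Sum>q\<in>{q \<in> K. R q p}. W q)))) =
      max 0 (min (W m) (1 - sum W ?K)) + min 1 (sum W ?K)"
    unfolding sum.remove[OF Suc.prems(1) m(1)] below_m IH[symmetric]
    using below by (intro arg_cong2[of _ _ _ _ "(+)"] sum.cong) auto
  moreover have "0 \<le> W m" using Suc.prems(2) m(1) by simp
  ultimately show ?case by (simp add: max_def min_def)
qed

lemma innermost1_nonneg: "0 \<le> innermost1 F tie v j D"
  by (simp add: innermost1_def)

lemma outermost_eqI:
  "D \<in> cuts_of F i \<Longrightarrow> (\<And>C. C \<in> cuts_of F i \<Longrightarrow> C \<subseteq> D) \<Longrightarrow> outermost F i = D"
  unfolding outermost_def by (rule Greatest_equality)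

locale round2 =
  fixes P :: "('v, 't) mcp" and tie :: "'t rel"
  assumes inst: "mcp_instance P"
    and tie: "strict_linear_order_on (terminals P) tie"
begin

lemma finite_verts: "finite (verts P)"
  using inst by (simp add: mcp_instance_def)

text \<open>\<open>loc\<close> embeds each of the finitely many commodities into the finite vertex
  set.\<close>

lemma finite_terminals: "finite (terminals P)"
proof -
  have "finite (comm P a)" if "a \<in> {1..ncomm P}" for a
  proof (rule inj_on_finite)
    show "inj_on (loc P) (comm P a)" "loc P ` comm P a \<subseteq> verts P"
      using inst that by (auto simp: mcp_instance_def)
  qed (rule finite_verts)
  then show ?thesis by (simp add: terminals_def)
qed

lemma frac_laminar_family_iff:
  "frac_laminar_family P T F \<longleftrightarrow>
    (\<forall>i C. 0 \<le> F i C) \<and> (\<forall>i C. i \<notin> T \<longrightarrow> F i C = 0) \<and>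
    (\<forall>i. \<forall>C\<in>cuts_of F i. is_cut P C \<and> loc P i \<in> C) \<and>
    (\<forall>i. \<forall>C\<in>cuts_of F i. \<forall>j. \<forall>D\<in>cuts_of F j. C \<inter> D = {} \<or> C \<subseteq> D \<or> D \<subseteq> C) \<and>
    (\<forall>i\<in>T. (\<Sum>C\<in>cuts_of F i. F i C) = 1)"
proof -
  have mem: "(\<forall>(i, C)\<in>members F. Q i C) \<longleftrightarrow> (\<forall>i. \<forall>C\<in>cuts_of F i. Q i C)" for Q
    by (auto simp: members_def)
  have cross: "\<not> crosses C D \<longleftrightarrow> C \<inter> D = {} \<or> C \<subseteq> D \<or> D \<subseteq> C" for C D :: "'v set"
    by (auto simp: crosses_def)
  show ?thesis unfolding frac_laminar_family_def mem cross ..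
qed

lemma edgeE:
  assumes "e \<in> edges P"
  obtains u v where "u \<in> verts P" "v \<in> verts P" "u \<noteq> v" "e = {u, v}"
proof -
  have "\<exists>u\<in>verts P. \<exists>v\<in>verts P. u \<noteq> v \<and> e = {u, v}"
    using inst assms by (simp add: mcp_instance_def)
  then show ?thesis using that by blast
qed

lemma cap_pos: "e \<in> edges P \<Longrightarrow> 0 < cap P e"
  using inst by (simp add: mcp_instance_def)

lemma mem_delta_iff:
  assumes "{u, v} \<in> edges P"
  shows "{u, v} \<in> delta P C \<longleftrightarrow> (u \<in> C) \<noteq> (v \<in> C)"
proof -
  have "u \<noteq> v" using assms by (elim edgeE) (auto simp: doubleton_eq_iff)
  then show ?thesis using assms by (auto simp: delta_def Int_insert_left)
qed

lemma delta_edgeE: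
  assumes "e \<in> delta P C"
  obtains u v where "e = {u, v}" "u \<noteq> v" "u \<in> C" "v \<notin> C" "{u, v} \<in> edges P"
proof -
  have e: "e \<in> edges P" using assms by (simp add: delta_def)
  then obtain u v where uv: "e = {u, v}" "u \<noteq> v" by (elim edgeE)
  then have "(u \<in> C) \<noteq> (v \<in> C)" using assms e mem_delta_iff by blast
  then show ?thesis using that[of u v] that[of v u] uv e by (auto simp: insert_commute)
qed

text \<open>Dominance with the map of outermost cuts as a parameter: the order can be fixed once by
  the preprocessed family while the current family changes.\<close>

definition prec :: "('t \<Rightarrow> 'v set) \<Rightarrow> 't \<Rightarrow> 't \<Rightarrow> bool" where
  "prec Om i j \<longleftrightarrow> Om i \<subset> Om j \<or> Om i = Om j \<and> (i, j) \<in> tie"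

lemma dominates_eq_prec: "dominates F tie = prec (outermost F)"
  by (simp add: fun_eq_iff dominates_def prec_def)

lemma prec_trans: "prec Om i j \<Longrightarrow> prec Om j k \<Longrightarrow> prec Om i k"
  using tie unfolding prec_def strict_linear_order_on_def trans_def by blast

lemma prec_irrefl: "\<not> prec Om i i"
  using tie by (auto simp: prec_def strict_linear_order_on_def irrefl_def)

lemma prec_subset: "prec Om i j \<Longrightarrow> Om i \<subseteq> Om j"
  by (auto simp: prec_def)

lemma prec_total:
  "\<lbrakk>i \<in> terminals P; j \<in> terminals P; i \<noteq> j; Om i \<subseteq> Om j \<or> Om j \<subseteq> Om i\<rbrakk> \<Longrightarrow> prec Om i j \<or> prec Om j i"
  using tie unfolding prec_def strict_linear_order_on_def total_on_def by blast

text \<open>The sum runs over all vertex sets, not over the support of \<open>F\<close>, so that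
  families with different supports, and \<open>innermost1\<close>, can be compared term by
  term.\<close>

definition weighted :: "'t set \<Rightarrow> ('v, 't) family \<Rightarrow> ('v set \<Rightarrow> real) \<Rightarrow> real" where
  "weighted T F g = (\<Sum>j\<in>T. \<Sum>C\<in>Pow (verts P). F j C * g C)"

text \<open>The share of the load of an edge \<open>{u, v}\<close> due to cuts on the side of
  \<open>u\<close>. An iteration acts differently on the two sides, so they are tracked
  separately.\<close>

definition only :: "'t set \<Rightarrow> ('v, 't) family \<Rightarrow> 'v \<Rightarrow> 'v \<Rightarrow> real" where
  "only T F u v = weighted T F (\<lambda>C. of_bool (u \<in> C \<and> v \<notin> C))"

lemma weighted_add: "weighted T F (\<lambda>C. g C + h C) = weighted T F g + weighted T F h"
  by (simp add: weighted_def algebra_simps sum.distrib)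

lemma weighted_cong:
  "(\<And>j C. j \<in> T \<Longrightarrow> C \<subseteq> verts P \<Longrightarrow> F j C * g C = G j C * h C) \<Longrightarrow> weighted T F g = weighted T G h"
  by (auto simp: weighted_def intro!: sum.cong)

lemma weighted_mono:
  "(\<And>j C. j \<in> T \<Longrightarrow> C \<subseteq> verts P \<Longrightarrow> F j C * g C \<le> G j C * h C) \<Longrightarrow> weighted T F g \<le> weighted T G h"
  by (auto simp: weighted_def intro!: sum_mono)

lemma weighted_nonneg:
  "(\<And>j C. j \<in> T \<Longrightarrow> C \<subseteq> verts P \<Longrightarrow> 0 \<le> F j C * g C) \<Longrightarrow> 0 \<le> weighted T F g"
  by (auto simp: weighted_def intro!: sum_nonneg)

lemma weighted_eq_0_iff:
  assumes "finite T" "\<And>j C. j \<in> T \<Longrightarrow> C \<subseteq> verts P \<Longrightarrow> 0 \<le> F j C * g C"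
  shows "weighted T F g = 0 \<longleftrightarrow> (\<forall>j\<in>T. \<forall>C\<subseteq>verts P. F j C * g C = 0)"
proof -
  have "(\<Sum>C\<in>Pow (verts P). F j C * g C) = 0 \<longleftrightarrow> (\<forall>C\<subseteq>verts P. F j C * g C = 0)" if "j \<in> T" for j
    using assms(2)[OF that] finite_verts by (subst sum_nonneg_eq_0_iff) auto
  then show ?thesis
    using assms unfolding weighted_def by (subst sum_nonneg_eq_0_iff) (auto intro!: sum_nonneg)
qed

section \<open>Chains of cuts, loads and depths in a fixed laminar family\<close>

context
  fixes T :: "'t set" and F :: "('v, 't) family"
  assumes fam: "frac_laminar_family P T F" and T: "T \<subseteq> terminals P"
begin

lemma finite_T: "finite T"
  using T finite_terminals by (rule finite_subset)

lemma F_nonneg: "0 \<le> F i C"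
  using fam by (simp add: frac_laminar_family_def)

lemma cuts_ofD:
  assumes "C \<in> cuts_of F i"
  shows "i \<in> T" "is_cut P C" "C \<subseteq> verts P" "loc P i \<in> C"
proof -
  show "i \<in> T" using fam assms unfolding frac_laminar_family_iff cuts_of_def by force
  have "is_cut P C \<and> loc P i \<in> C" using fam assms by (simp add: frac_laminar_family_iff)
  then show "is_cut P C" "C \<subseteq> verts P" "loc P i \<in> C" by (auto simp: is_cut_def)
qed

lemma members_subset: "members F \<subseteq> T \<times> Pow (verts P)"
  using cuts_ofD(1,3) unfolding members_def by blast

lemma F_eq_0: "C \<notin> cuts_of F i \<Longrightarrow> F i C = 0"
  using F_nonneg[of i C] by (auto simp: cuts_of_def)

lemma laminar: "C \<in> cuts_of F i \<Longrightarrow> D \<in> cuts_of F j \<Longrightarrow> x \<in> C \<Longrightarrow> x \<in> D \<Longrightarrow> C \<subseteq> D \<or> D \<subseteq> C"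
  using fam unfolding frac_laminar_family_iff by blast

lemma finite_cuts_of: "finite (cuts_of F i)"
  by (rule finite_subset[of _ "Pow (verts P)"]) (auto dest: cuts_ofD(3) simp: finite_verts)

lemma sum_cuts_of: "(\<Sum>C\<in>cuts_of F i. F i C * g C) = (\<Sum>C\<in>Pow (verts P). F i C * g C)"
  by (rule sum.mono_neutral_left) (auto dest: cuts_ofD(3) simp: finite_verts F_eq_0)

lemma weight_1: "i \<in> T \<Longrightarrow> (\<Sum>C\<in>Pow (verts P). F i C) = 1"
  using sum_cuts_of[of i "\<lambda>_. 1"] fam by (simp add: frac_laminar_family_def)

lemma cuts_of_nonempty: "i \<in> T \<Longrightarrow> cuts_of F i \<noteq> {}"
  using fam by (force simp: frac_laminar_family_def)

lemma sum_members:
  "(\<Sum>(i, C)\<in>{(i, C) \<in> members F. Q i C}. F i C) =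
   (\<Sum>i\<in>T. \<Sum>C\<in>Pow (verts P). F i C * of_bool (Q i C))"
  unfolding sum.cartesian_product
proof (rule sum.mono_neutral_cong_left)
  show "finite (T \<times> Pow (verts P))" using finite_T finite_verts by simp
  show "{(i, C). (i, C) \<in> members F \<and> Q i C} \<subseteq> T \<times> Pow (verts P)" using members_subset by blast
  show "\<forall>p\<in>T \<times> Pow (verts P) - {(i, C). (i, C) \<in> members F \<and> Q i C}.
      (case p of (i, C) \<Rightarrow> F i C * of_bool (Q i C)) = 0"
    using F_eq_0 by (fastforce simp: members_def)
qed auto

lemma depth_eq: "depth F v = weighted T F (\<lambda>C. of_bool (v \<in> C))"
  using sum_members[of "\<lambda>i C. v \<in> C"] by (simp add: depth_def cuts_at_def weighted_def)

lemma load_eq: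
  assumes "{u, v} \<in> edges P"
  shows "frac_load P F {u, v} = only T F u v + only T F v u"
  unfolding frac_load_def only_def weighted_add[symmetric]
  using sum_members[of "\<lambda>i C. {u, v} \<in> delta P C"]
  by (auto simp: mem_delta_iff[OF assms] weighted_def intro!: sum.cong)

lemma only_nonneg: "0 \<le> only T F u v"
  unfolding only_def by (rule weighted_nonneg) (simp add: F_nonneg)

lemma only_eq_0_iff: "only T F u v = 0 \<longleftrightarrow> (\<forall>i. \<forall>C\<in>cuts_of F i. u \<in> C \<longrightarrow> v \<in> C)"
  unfolding only_def
proof (subst weighted_eq_0_iff)
  show "(\<forall>j\<in>T. \<forall>C\<subseteq>verts P. F j C * of_bool (u \<in> C \<and> v \<notin> C) = 0) \<longleftrightarrow>
    (\<forall>i. \<forall>C\<in>cuts_of F i. u \<in> C \<longrightarrow> v \<in> C)"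
  proof
    assume *: "\<forall>j\<in>T. \<forall>C\<subseteq>verts P. F j C * of_bool (u \<in> C \<and> v \<notin> C) = 0"
    show "\<forall>i. \<forall>C\<in>cuts_of F i. u \<in> C \<longrightarrow> v \<in> C"
    proof (intro allI ballI)
      fix i C assume C: "C \<in> cuts_of F i"
      have "F i C * of_bool (u \<in> C \<and> v \<notin> C) = 0"
        using * cuts_ofD(1,3)[OF C] by blast
      then show "u \<in> C \<longrightarrow> v \<in> C" using C by (auto simp: cuts_of_def)
    qed
  next
    assume *: "\<forall>i. \<forall>C\<in>cuts_of F i. u \<in> C \<longrightarrow> v \<in> C"
    then show "\<forall>j\<in>T. \<forall>C\<subseteq>verts P. F j C * of_bool (u \<in> C \<and> v \<notin> C) = 0"
      using F_eq_0 by (metis mult_eq_0_iff of_bool_eq_0_iff)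
  qed
qed (auto simp: F_nonneg finite_T)

text \<open>Cuts around both vertices count for both depths and cancel. This turns the choice of a
  deepest terminal into an inequality between the two sides of an edge.\<close>

lemma depth_diff: "depth F u - depth F v = only T F u v - only T F v u"
proof -
  have "depth F u + only T F v u = depth F v + only T F u v"
    unfolding depth_eq only_def weighted_add[symmetric] by (rule weighted_cong) auto
  then show ?thesis by simp
qed

text \<open>All cuts of \<open>i\<close> contain \<open>loc P i\<close>, so laminarity makes them a
  chain and a maximal one is greatest.\<close>

lemma outermost_greatest:
  assumes "i \<in> T"
  shows "outermost F i \<in> cuts_of F i" "C \<in> cuts_of F i \<Longrightarrow> C \<subseteq> outermost F i"
proof -
  obtain D where D: "D \<in> cuts_of F i" "\<And>C. C \<in> cuts_of F i \<Longrightarrow> D \<subseteq> C \<Longrightarrow> D = C"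
    using finite_has_maximal[OF finite_cuts_of cuts_of_nonempty[OF assms]] by blast
  have *: "C \<subseteq> D" if "C \<in> cuts_of F i" for C
    using laminar[OF that D(1) cuts_ofD(4)[OF that] cuts_ofD(4)[OF D(1)]] D(2)[OF that] by auto
  have "outermost F i = D"
    unfolding outermost_def using D(1) * by (rule Greatest_equality)
  then show "outermost F i \<in> cuts_of F i" "C \<in> cuts_of F i \<Longrightarrow> C \<subseteq> outermost F i"
    using D(1) * by auto
qed

text \<open>The outermost cuts of both owners contain \<open>x\<close> and are therefore
  comparable.\<close>

lemma prec_total_at:
  assumes "C \<in> cuts_of F i" "D \<in> cuts_of F j" "x \<in> C" "x \<in> D" "i \<noteq> j"
  shows "prec (outermost F) i j \<or> prec (outermost F) j i"
proof (rule prec_total)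
  show "i \<in> terminals P" "j \<in> terminals P" using assms cuts_ofD(1) T by auto
  have "i \<in> T" "j \<in> T" using assms cuts_ofD(1) by auto
  then show "outermost F i \<subseteq> outermost F j \<or> outermost F j \<subseteq> outermost F i"
    using laminar[of "outermost F i" i "outermost F j" j x] outermost_greatest assms by blast
qed (rule assms)

text \<open>Cuts around \<open>v\<close> form a chain by laminarity; copies of one set have distinct
  owners, and dominance decides between these because their outermost cuts share
  \<open>v\<close>.\<close>

lemma inner_order:
  shows "asymp_on (cuts_at F v) (Defs.inner F tie)" "transp_on (cuts_at F v) (Defs.inner F tie)"
    "totalp_on (cuts_at F v) (Defs.inner F tie)"
proof -
  show "asymp_on (cuts_at F v) (Defs.inner F tie)"
    using prec_irrefl prec_trans
    by (fastforce simp: asymp_on_def Defs.inner_def dominates_eq_prec)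
  show "transp_on (cuts_at F v) (Defs.inner F tie)"
    using prec_trans by (fastforce simp: transp_on_def Defs.inner_def dominates_eq_prec)
  show "totalp_on (cuts_at F v) (Defs.inner F tie)"
  proof (rule totalp_onI)
    fix p q
    assume "p \<in> cuts_at F v" "q \<in> cuts_at F v" and ne: "p \<noteq> q"
    moreover obtain i C j D where pq: "p = (i, C)" "q = (j, D)" by (metis surj_pair)
    ultimately have C: "C \<in> cuts_of F i" "v \<in> C" and D: "D \<in> cuts_of F j" "v \<in> D"
      by (auto simp: cuts_at_def members_def)
    show "Defs.inner F tie p q \<or> Defs.inner F tie q p"
      using laminar[OF C(1) D(1) C(2) D(2)] prec_total_at[OF C(1) D(1) C(2) D(2)] ne pq
      by (auto simp: Defs.inner_def dominates_eq_prec)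
  qed
qed

lemma finite_cuts_at: "finite (cuts_at F v)"
  by (rule finite_subset[of _ "T \<times> Pow (verts P)"])
    (use members_subset finite_T finite_verts in \<open>auto simp: cuts_at_def\<close>)

section \<open>The innermost unit of cuts around a vertex\<close>

lemma innermost1_le: "innermost1 F tie v j D \<le> F j D"
  by (auto simp: innermost1_def F_nonneg)

lemma innermost1_posD:
  assumes "0 < innermost1 F tie v j D"
  shows "D \<in> cuts_of F j" "v \<in> D" "(\<Sum>(i, C)\<in>{p \<in> cuts_at F v. Defs.inner F tie p (j, D)}. F i C) < 1"
  using assms by (auto simp: innermost1_def cuts_at_def members_def split: if_splits)

text \<open>The weight before \<open>(j, D)\<close> is below 1 because something is taken from
  \<open>D\<close>. It includes \<open>C\<close> and all that precedes \<open>C\<close>, so nothing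
  of \<open>C\<close> is left over.\<close>

lemma innermost1_inner:
  assumes pos: "0 < innermost1 F tie v j D" and C: "C \<in> cuts_of F i" "v \<in> C"
    and CD: "Defs.inner F tie (i, C) (j, D)"
  shows "innermost1 F tie v i C = F i C"
proof -
  let ?K = "cuts_at F v" and ?I = "Defs.inner F tie" and ?W = "\<lambda>(i, C). F i C"
  have iC: "(i, C) \<in> ?K" using C by (auto simp: cuts_at_def members_def)
  have jD: "(j, D) \<in> ?K" using innermost1_posD[OF pos] by (auto simp: cuts_at_def members_def)
  have "sum ?W {p \<in> ?K. ?I p (i, C)} + F i C = sum ?W (insert (i, C) {p \<in> ?K. ?I p (i, C)})"
    using inner_order(1)[of v] iC finite_cuts_at by (subst sum.insert) (auto simp: asymp_on_def)
  also have "\<dots> \<le> sum ?W {p \<in> ?K. ?I p (j, D)}"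
  proof (rule sum_mono2)
    have "?I p (j, D)" if "p \<in> ?K" "?I p (i, C)" for p
      using transp_onD[OF inner_order(2) that(1) iC jD that(2) CD] .
    then show "insert (i, C) {p \<in> ?K. ?I p (i, C)} \<subseteq> {p \<in> ?K. ?I p (j, D)}"
      using iC CD by auto
  qed (auto simp: finite_cuts_at F_nonneg)
  also have "\<dots> < 1" by (rule innermost1_posD(3)[OF pos])
  finally show ?thesis using iC F_nonneg[of i C] by (auto simp: innermost1_def)
qed

lemma innermost1_total:
  assumes "1 \<le> depth F v"
  shows "weighted T (innermost1 F tie v) (\<lambda>_. 1) = 1"
proof -
  let ?K = "cuts_at F v" and ?I = "Defs.inner F tie" and ?W = "\<lambda>(i, C). F i C"
  have "(\<Sum>p\<in>?K. max 0 (min (?W p) (1 - (\<Sum>q\<in>{q \<in> ?K. ?I q p}. ?W q)))) = min 1 (sum ?W ?K)"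
    by (rule sum_take_inner_weight) (use finite_cuts_at inner_order F_nonneg in auto)
  also have "\<dots> = 1" using assms by (simp add: depth_def)
  also have "(\<Sum>p\<in>?K. max 0 (min (?W p) (1 - (\<Sum>q\<in>{q \<in> ?K. ?I q p}. ?W q)))) =
      (\<Sum>(j, C)\<in>T \<times> Pow (verts P). innermost1 F tie v j C)"
    by (rule sum.mono_neutral_cong_left)
      (use finite_T finite_verts members_subset in \<open>auto simp: innermost1_def cuts_at_def split: if_splits\<close>)
  finally show ?thesis by (simp add: weighted_def sum.cartesian_product)
qed

end

end

section \<open>One iteration\<close>

text \<open>The facts about the state on which one iteration relies; those on \<open>meta s\<close>
  say that meta-nodes are equivalence classes and that each cut is a union of them.\<close>

locale iteration = round2 P tie for P :: "('v, 't) mcp" and tie :: "'t rel" +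
  fixes s :: "('v, 't) state" and i :: 't
  assumes fam: "frac_laminar_family P (todo s) (fam s)"
    and todo: "todo s \<subseteq> terminals P"
    and incl: "inclusion_invariant P (todo s) tie (fam s)"
    and respects: "\<And>j C v. C \<in> cuts_of (fam s) j \<Longrightarrow> v \<in> C \<Longrightarrow> meta s v \<subseteq> C"
    and meta_refl: "\<And>v. v \<in> meta s v"
    and meta_eq: "\<And>v w. w \<in> meta s v \<Longrightarrow> meta s w = meta s v"
    and selectable: "selectable P tie s i"
begin

abbreviation "F \<equiv> fam s"
abbreviation "T \<equiv> todo s"
abbreviation "r \<equiv> loc P i"
abbreviation "M \<equiv> meta s (loc P i)"
abbreviation "K1 \<equiv> innermost1 (fam s) tie (loc P i)"
abbreviation "F' \<equiv> shrink P tie s i"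

lemmas F_cutD = cuts_ofD[OF fam todo]

section \<open>Consequences of the selection rule\<close>

lemma i_todo: "i \<in> T"
  and depth_le: "j \<in> T \<Longrightarrow> depth F (loc P j) \<le> depth F r"
  using selectable by (auto simp: selectable_def Let_def)

lemma undominated: "j \<in> T \<Longrightarrow> depth F r \<le> depth F (loc P j) \<Longrightarrow> \<not> prec (outermost F) j i"
  using selectable unfolding selectable_def Let_def dominates_eq_prec by force

lemma inclusion:
  "\<lbrakk>prec (outermost F) j k; C \<in> cuts_of F j; D \<in> cuts_of F k; loc P k \<in> C; loc P j \<in> D\<rbrakk> \<Longrightarrow> C \<subseteq> D"
proof -
  assume *: "prec (outermost F) j k" "C \<in> cuts_of F j" "D \<in> cuts_of F k" "loc P k \<in> C" "loc P j \<in> D"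
  have "{loc P j, loc P k} \<subseteq> C \<inter> D"
    using * F_cutD(4)[OF *(2)] F_cutD(4)[OF *(3)] by blast
  then show "C \<subseteq> D"
    using incl F_cutD(1)[OF *(2)] F_cutD(1)[OF *(3)] *
    unfolding inclusion_invariant_def dominates_eq_prec by blast
qed

lemma mem_meta: "v \<in> M \<Longrightarrow> C \<in> cuts_of F j \<Longrightarrow> v \<in> C \<longleftrightarrow> r \<in> C"
  using respects meta_refl meta_eq by blast

lemma minimal_cut:
  assumes "C \<in> cuts_of F j" "v \<in> C"
  shows "\<exists>q. \<exists>D\<in>cuts_of F q. v \<in> D \<and> (\<forall>k. \<forall>E\<in>cuts_of F k. v \<in> E \<longrightarrow> D \<subseteq> E)"
proof -
  let ?S = "{C. v \<in> C \<and> (\<exists>j. C \<in> cuts_of F j)}"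
  have "?S \<subseteq> Pow (verts P)" using F_cutD(3) by blast
  then have "finite ?S" using finite_verts finite_subset by blast
  moreover have "?S \<noteq> {}" using assms by blast
  ultimately have "\<exists>D\<in>?S. \<forall>C\<in>?S. C \<subseteq> D \<longrightarrow> D = C" by (rule finite_has_minimal)
  then obtain D where D: "D \<in> ?S" "\<And>C. C \<in> ?S \<Longrightarrow> C \<subseteq> D \<Longrightarrow> D = C" by meson
  then obtain q where q: "D \<in> cuts_of F q" "v \<in> D" by blast
  have "D \<subseteq> E" if E: "E \<in> cuts_of F k" "v \<in> E" for k E
  proof -
    have "E \<in> ?S" using E by blast
    then show ?thesis using laminar[OF fam todo E(1) q(1) E(2) q(2)] D(2)[of E] by metis
  qed
  then show ?thesis using q by (intro exI[of _ q] bexI[of _ D]) simp_all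
qed

lemma depth_mono:
  assumes "\<And>j C. C \<in> cuts_of F j \<Longrightarrow> u \<in> C \<Longrightarrow> v \<in> C"
  shows "depth F u \<le> depth F v"
proof -
  have "only T F u v = 0" using only_eq_0_iff[OF fam todo] assms by blast
  then show ?thesis using depth_diff[OF fam todo, of u v] only_nonneg[OF fam todo, of v u] by simp
qed

text \<open>Extends maximality from terminals to all vertices: the innermost cut around
  \<open>v\<close> contains the location of its owner, which thus lies in every cut around
  \<open>v\<close>.\<close>

lemma depth_max: "depth F v \<le> depth F r"
proof (cases "\<exists>j C. C \<in> cuts_of F j \<and> v \<in> C")
  case False
  then show ?thesis by (intro depth_mono) blast
next
  case True
  then obtain q D where D: "D \<in> cuts_of F q" "v \<in> D"
    "\<And>k E. E \<in> cuts_of F k \<Longrightarrow> v \<in> E \<Longrightarrow> D \<subseteq> E"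
    using minimal_cut by meson
  then have "depth F v \<le> depth F (loc P q)"
    using F_cutD(4)[OF D(1)] by (intro depth_mono) blast
  then show ?thesis using depth_le[OF F_cutD(1)[OF D(1)]] by simp
qed

text \<open>All vertices of \<open>M\<close> lie in the same cuts as \<open>r\<close>, so
  \<open>v\<close> is as deep as \<open>r\<close>.\<close>

lemma only_le: "v \<in> M \<Longrightarrow> only T F u v \<le> only T F v u"
proof -
  assume v: "v \<in> M"
  have "depth F r \<le> depth F v" by (rule depth_mono) (simp add: mem_meta[OF v])
  then show ?thesis using depth_diff[OF fam todo, of v u] depth_max[of u] by simp
qed

text \<open>Serves to replace a cut of another terminal that separates \<open>r\<close> from some
  vertex by a cut of \<open>i\<close> itself.\<close>

lemma own_innermost_cut:
  obtains C where "C \<in> cuts_of F i" "\<And>j D. D \<in> cuts_of F j \<Longrightarrow> r \<in> D \<Longrightarrow> C \<subseteq> D"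
proof -
  obtain C where C: "C \<in> cuts_of F i" using cuts_of_nonempty[OF fam todo i_todo] by blast
  obtain q D where D: "D \<in> cuts_of F q" "r \<in> D"
    "\<And>k E. E \<in> cuts_of F k \<Longrightarrow> r \<in> E \<Longrightarrow> D \<subseteq> E"
    using minimal_cut[OF C F_cutD(4)[OF C]] by meson
  show ?thesis
  proof (cases "q = i")
    case True
    then show ?thesis using that D by blast
  next
    case False
    \<comment> \<open>\<open>D\<close> lies inside every cut around \<open>r\<close>, so its owner
      \<open>q\<close> is at least as deep as \<open>i\<close>. As \<open>i\<close> is undominated
      among the deepest, \<open>i\<close> precedes \<open>q\<close>, and the inclusion invariant
      applies.\<close>
    have q: "loc P q \<in> E" if "E \<in> cuts_of F k" "r \<in> E" for k E
      using D(3)[OF that] F_cutD(4)[OF D(1)] by blast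
    then have "depth F r \<le> depth F (loc P q)" by (rule depth_mono)
    then have "\<not> prec (outermost F) q i" using undominated F_cutD(1)[OF D(1)] by blast
    then have "prec (outermost F) i q"
      using prec_total_at[OF fam todo D(1) C D(2) F_cutD(4)[OF C] False] by blast
    then have "C \<subseteq> D" using inclusion[OF _ C D(1) q[OF C F_cutD(4)[OF C]] D(2)] by blast
    then show ?thesis using that[OF C] D(3) by (meson order.trans)
  qed
qed

text \<open>The cuts of \<open>i\<close> weigh 1 in total; if all precede \<open>C\<close>, the unit
  is complete before \<open>C\<close> is reached.\<close>

lemma own_cuts_before:
  assumes "\<And>D. D \<in> cuts_of F i \<Longrightarrow> Defs.inner F tie (i, D) (j, C)"
  shows "\<not> 0 < K1 j C"
proof
  assume "0 < K1 j C"
  then have "(\<Sum>(k, D)\<in>{p \<in> cuts_at F r. Defs.inner F tie p (j, C)}. F k D) < 1"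
    by (rule innermost1_posD[OF fam todo])
  moreover have "(\<Sum>(k, D)\<in>{i} \<times> cuts_of F i. F k D) \<le>
      (\<Sum>(k, D)\<in>{p \<in> cuts_at F r. Defs.inner F tie p (j, C)}. F k D)"
  proof (rule sum_mono2)
    show "{i} \<times> cuts_of F i \<subseteq> {p \<in> cuts_at F r. Defs.inner F tie p (j, C)}"
      using F_cutD(4) assms by (auto simp: cuts_at_def members_def)
  qed (auto simp: finite_cuts_at[OF fam todo] F_nonneg[OF fam todo])
  moreover have "(\<Sum>(k, D)\<in>{i} \<times> cuts_of F i. F k D) = 1"
    using fam i_todo by (simp add: frac_laminar_family_iff sum.cartesian_product[symmetric])
  ultimately show False by simp
qed

text \<open>If \<open>i\<close> dominated \<open>j\<close> instead, the inclusion invariant would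
  put every cut of \<open>i\<close> before \<open>C\<close>.\<close>

lemma K1_owner:
  assumes "0 < K1 j C" "j \<noteq> i"
  shows "prec (outermost F) j i"
proof (rule ccontr)
  assume not: "\<not> prec (outermost F) j i"
  note C = innermost1_posD(1,2)[OF fam todo assms(1)]
  obtain D where "D \<in> cuts_of F i" using cuts_of_nonempty[OF fam todo i_todo] by blast
  then have ij: "prec (outermost F) i j"
    using prec_total_at[OF fam todo C(1) _ C(2) F_cutD(4) assms(2)] not by blast
  have "Defs.inner F tie (i, D) (j, C)" if D: "D \<in> cuts_of F i" for D
  proof -
    \<comment> \<open>In the case \<open>C \<subseteq> D\<close> of laminarity,
      \<open>loc P j\<close> lies in \<open>D\<close>, and the inclusion invariant yields the other
      containment.\<close>
    have "D \<subseteq> C"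
      using laminar[OF fam todo D C(1) F_cutD(4)[OF D] C(2)] inclusion[OF ij D C(1)] C(2)
        F_cutD(4)[OF C(1)] by blast
    then show ?thesis using ij by (auto simp: Defs.inner_def dominates_eq_prec)
  qed
  then show False using own_cuts_before assms(1) by blast
qed

text \<open>\<open>j\<close> is as deep as \<open>i\<close>, so the selection rule excludes that it
  dominates \<open>i\<close>.\<close>

lemma same_meta_dominated:
  assumes j: "j \<in> T" "j \<noteq> i" "loc P j \<in> M"
  shows "prec (outermost F) i j"
proof -
  have "depth F r \<le> depth F (loc P j)" by (rule depth_mono) (simp add: mem_meta[OF j(3)])
  then have "\<not> prec (outermost F) j i" using undominated j(1) by blast
  moreover obtain C where C: "C \<in> cuts_of F j" using cuts_of_nonempty[OF fam todo j(1)] by blast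
  moreover obtain D where D: "D \<in> cuts_of F i" using cuts_of_nonempty[OF fam todo i_todo] by blast
  ultimately show ?thesis
    using prec_total_at[OF fam todo C D _ F_cutD(4)[OF D] j(2)] mem_meta[OF j(3) C]
      F_cutD(4)[OF C] by blast
qed

text \<open>Otherwise \<open>i\<close> and \<open>j\<close> would dominate each other. Hence a cut
  of \<open>j\<close> still contains the location of \<open>j\<close> after \<open>M\<close> is
  removed from it.\<close>

lemma K1_loc:
  assumes "0 < K1 j C" "j \<noteq> i"
  shows "loc P j \<notin> M"
  using K1_owner[OF assms] same_meta_dominated[of j] assms(2) prec_trans prec_irrefl
    F_cutD(1)[OF innermost1_posD(1)[OF fam todo assms(1)]] by blast

text \<open>A copy of the outermost cut survives, which keeps dominance unchanged. If all of it were
  taken, \<open>loc P j\<close> would be at least as deep as \<open>r\<close>: it lies in the full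
  unit of cuts of \<open>j\<close> and in all cuts around \<open>r\<close> listed after
  \<open>B\<close>, while the cuts up to \<open>B\<close> weigh at most 1. Then \<open>j\<close>
  could not dominate \<open>i\<close>.\<close>

lemma outermost_not_used_up:
  assumes j: "j \<in> T" "j \<noteq> i"
  shows "K1 j (outermost F j) < F j (outermost F j)"
proof (rule ccontr)
  define B where "B = outermost F j"
  note B = outermost_greatest[OF fam todo j(1), folded B_def]
  assume "\<not> ?thesis"
  then have eq: "K1 j B = F j B"
    using innermost1_le[OF fam todo, of r j B] by (simp add: B_def)
  then have pos: "0 < K1 j B" using B(1) by (simp add: cuts_of_def)
  note rB = innermost1_posD(2)[OF fam todo pos]
  let ?K = "cuts_at F r" and ?I = "Defs.inner F tie" and ?W = "\<lambda>(i, C). F i C"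
  have jB: "(j, B) \<in> ?K" using B(1) rB by (auto simp: cuts_at_def members_def)
  \<comment> \<open>The initial segment of the cuts around \<open>r\<close> that ends with the
    outermost cut of \<open>j\<close>.\<close>
  define A where "A = insert (j, B) {p \<in> ?K. ?I p (j, B)}"
  have AK: "A \<subseteq> ?K" using jB by (auto simp: A_def)
  have fin: "finite ?K" by (rule finite_cuts_at[OF fam todo])
  have "sum ?W A = F j B + sum ?W {p \<in> ?K. ?I p (j, B)}"
    unfolding A_def using fin inner_order(1)[OF fam todo, of r] jB
    by (subst sum.insert) (auto simp: asymp_on_def)
  also have "\<dots> \<le> 1"
    using eq pos jB by (auto simp: innermost1_def split: if_splits)
  finally have A1: "sum ?W A \<le> 1" .
  have "depth F r = sum ?W A + sum ?W (?K - A)"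
    unfolding depth_def using sum.subset_diff[OF AK fin, of ?W] by simp
  also have "\<dots> \<le> sum ?W ({j} \<times> cuts_of F j) + sum ?W (?K - A)"
  proof -
    have "sum ?W ({j} \<times> cuts_of F j) = 1"
      using fam j(1) by (simp add: frac_laminar_family_iff sum.cartesian_product[symmetric])
    then show ?thesis using A1 by simp
  qed
  also have "\<dots> = sum ?W ({j} \<times> cuts_of F j \<union> (?K - A))"
  proof (rule sum.union_disjoint[symmetric])
    show "{j} \<times> cuts_of F j \<inter> (?K - A) = {}"
      using B(2) by (auto simp: A_def Defs.inner_def)
  qed (use fin finite_cuts_of[OF fam todo] in auto)
  also have "\<dots> \<le> depth F (loc P j)"
    unfolding depth_def
  proof (rule sum_mono2)
    have "B \<subseteq> D" if "(q, D) \<in> ?K - A" for q D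
      using totalp_onD[OF inner_order(3)[OF fam todo, of r], of "(q, D)" "(j, B)"] that jB
      unfolding A_def Defs.inner_def by auto
    then show "{j} \<times> cuts_of F j \<union> (?K - A) \<subseteq> cuts_at F (loc P j)"
      using F_cutD(4) B(1) by (fastforce simp: cuts_at_def members_def)
  qed (auto simp: finite_cuts_at[OF fam todo] F_nonneg[OF fam todo])
  finally have "\<not> prec (outermost F) j i" using undominated j(1) by blast
  then show False using K1_owner[OF pos j(2)] by blast
qed

lemma depth_ge_1: "1 \<le> depth F r"
proof -
  have "(\<Sum>(k, D)\<in>{i} \<times> cuts_of F i. F k D) \<le> depth F r"
    unfolding depth_def
  proof (rule sum_mono2)
    show "{i} \<times> cuts_of F i \<subseteq> cuts_at F r"
      using F_cutD(4) by (auto simp: cuts_at_def members_def)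
  qed (auto simp: finite_cuts_at[OF fam todo] F_nonneg[OF fam todo])
  then show ?thesis
    using fam i_todo by (simp add: frac_laminar_family_iff sum.cartesian_product[symmetric])
qed

section \<open>The family after shrinking\<close>

lemma K1_pos_iff: "0 < K1 j C \<longleftrightarrow> K1 j C \<noteq> 0"
  using innermost1_nonneg[of F tie r j C] by auto

text \<open>Shrinking moves the weight \<open>K1 j C\<close> from \<open>C\<close> to
  \<open>C - M\<close>; the moved weights, grouped by target in \<open>shrink\<close>, are summed
  here by source.\<close>

lemma sum_shrink:
  assumes "j \<in> T - {i}"
  shows "(\<Sum>D\<in>Pow (verts P). F' j D * g D) =
    (\<Sum>C\<in>Pow (verts P). (F j C - K1 j C) * g C + K1 j C * g (C - M))"
proof -
  let ?V = "Pow (verts P)"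
  have "(\<Sum>D\<in>?V. (\<Sum>C\<in>{C \<in> cuts_of F j. C - M = D}. K1 j C) * g D) =
      (\<Sum>D\<in>?V. \<Sum>C\<in>{C \<in> cuts_of F j. C - M = D}. K1 j C * g (C - M))"
    by (simp add: sum_distrib_right)
  also have "\<dots> = (\<Sum>C\<in>cuts_of F j. K1 j C * g (C - M))"
    by (rule sum.group) (use finite_cuts_of[OF fam todo] finite_verts F_cutD(3) in auto)
  also have "\<dots> = (\<Sum>C\<in>?V. K1 j C * g (C - M))"
  proof (rule sum.mono_neutral_left)
    show "\<forall>C\<in>?V - cuts_of F j. K1 j C * g (C - M) = 0"
      using innermost1_posD(1)[OF fam todo, of r j] by (auto simp: K1_pos_iff)
  qed (use finite_verts F_cutD(3) in auto)
  finally show ?thesis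
    using assms by (simp add: shrink_def Let_def sum.distrib ring_distribs)
qed

lemma shrink_eq_0: "j \<notin> T - {i} \<Longrightarrow> F' j D = 0"
  by (auto simp: shrink_def)

lemma shrink_nonneg: "0 \<le> F' j D"
  using innermost1_le[OF fam todo, of r j D]
  by (auto simp: shrink_def Let_def innermost1_nonneg intro!: add_nonneg_nonneg sum_nonneg)

lemma shrink_cuts_iff:
  "D \<in> cuts_of F' j \<longleftrightarrow> j \<in> T - {i} \<and> (K1 j D < F j D \<or> (\<exists>C. 0 < K1 j C \<and> D = C - M))"
proof (cases "j \<in> T - {i}")
  case True
  let ?S = "{C \<in> cuts_of F j. C - M = D}"
  have "0 \<le> F j D - K1 j D" using innermost1_le[OF fam todo, of r j D] by simp
  moreover have "0 \<le> sum (K1 j) ?S" by (simp add: sum_nonneg innermost1_nonneg)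
  moreover have "sum (K1 j) ?S = 0 \<longleftrightarrow> (\<forall>C\<in>?S. K1 j C = 0)"
    using finite_cuts_of[OF fam todo] by (intro sum_nonneg_eq_0_iff) (auto simp: innermost1_nonneg)
  moreover have "(\<forall>C\<in>?S. K1 j C = 0) \<longleftrightarrow> \<not> (\<exists>C. 0 < K1 j C \<and> D = C - M)"
    using innermost1_posD(1)[OF fam todo, of r j] by (auto simp: K1_pos_iff)
  ultimately show ?thesis
    using True by (auto simp: cuts_of_def shrink_def Let_def)
qed (auto simp: cuts_of_def shrink_eq_0)

lemma shrink_cutE:
  assumes "D \<in> cuts_of F' j"
  obtains (kept) "j \<in> T" "j \<noteq> i" "D \<in> cuts_of F j" "K1 j D < F j D"
  | (shrunk) C where "j \<in> T" "j \<noteq> i" "C \<in> cuts_of F j" "r \<in> C" "0 < K1 j C" "D = C - M" "loc P j \<notin> M"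
proof -
  have "D \<in> cuts_of F j" if "K1 j D < F j D"
    using that innermost1_nonneg[of F tie r j D] by (simp add: cuts_of_def)
  then show ?thesis
    using assms kept shrunk innermost1_posD(1,2)[OF fam todo] K1_loc unfolding shrink_cuts_iff by blast
qed

lemma shrink_respects:
  assumes "D \<in> cuts_of F' j" "v \<in> D"
  shows "meta s v \<subseteq> D"
  using assms(1)
proof (cases rule: shrink_cutE)
  case kept
  then show ?thesis using respects assms(2) by blast
next
  case (shrunk C)
  moreover have "meta s v \<inter> M = {}" using shrunk assms(2) meta_eq meta_refl by blast
  ultimately show ?thesis using respects assms(2) by blast
qed

lemma shrink_origin:
  assumes "D \<in> cuts_of F' j"
  obtains C where "j \<in> T" "j \<noteq> i" "C \<in> cuts_of F j" "D \<subseteq> C" "C - M \<subseteq> D" "loc P j \<in> D"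
  using assms
proof (cases rule: shrink_cutE)
  case kept
  then show ?thesis using that F_cutD(4) by blast
next
  case (shrunk C)
  then show ?thesis using that[of C] F_cutD(4) by blast
qed

lemma outermost_shrink:
  assumes "j \<in> T - {i}"
  shows "outermost F' j = outermost F j"
proof (rule outermost_eqI)
  show "outermost F j \<in> cuts_of F' j"
    using outermost_not_used_up assms by (auto simp: shrink_cuts_iff)
  show "D \<subseteq> outermost F j" if "D \<in> cuts_of F' j" for D
    using that outermost_greatest(2)[OF fam todo] by (elim shrink_origin) blast
qed

text \<open>A cut is shrunk only after all its subsets, up to equal sets whose owner is dominated.\<close>

lemma shrink_mono:
  assumes C: "C \<in> cuts_of F' j" and D: "D \<in> cuts_of F' k"
    and sub: "\<And>C0 D0. C0 \<in> cuts_of F j \<Longrightarrow> D0 \<in> cuts_of F k \<Longrightarrow> C \<subseteq> C0 \<Longrightarrow> D \<subseteq> D0 \<Longrightarrow>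
      C0 \<subset> D0 \<or> C0 = D0 \<and> prec (outermost F) j k"
  shows "C \<subseteq> D"
  using C
proof (cases rule: shrink_cutE)
  case c: kept
  show ?thesis
    using D
  proof (cases rule: shrink_cutE)
    case kept
    then show ?thesis using sub c by blast
  next
    case (shrunk D0)
    have s: "C \<subset> D0 \<or> C = D0 \<and> prec (outermost F) j k" using sub[OF c(3) shrunk(3)] shrunk(6) by blast
    then have "Defs.inner F tie (j, C) (k, D0)" by (auto simp: Defs.inner_def dominates_eq_prec)
    \<comment> \<open>A cut around \<open>r\<close> that precedes \<open>D0\<close> would have been
      taken completely, yet part of \<open>C\<close> is left. So \<open>C\<close> misses
      \<open>M\<close> and remains inside \<open>D0 - M\<close>.\<close>
    then have "r \<notin> C"
      using innermost1_inner[OF fam todo shrunk(5) c(3)] c(4) by fastforce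
    then have "C \<inter> M = {}" using mem_meta c(3) by blast
    then show ?thesis using s shrunk(6) by blast
  qed
next
  case c: (shrunk C0)
  show ?thesis
    using D
  proof (cases rule: shrink_cutE)
    case kept
    then show ?thesis using sub[OF c(3) kept(3)] c(6) by blast
  next
    case (shrunk D0)
    then show ?thesis using sub[OF c(3) shrunk(3)] c(6) by blast
  qed
qed

text \<open>The originals of two intersecting cuts are nested. If they differ, only an unshrunk copy
  of the smaller against a shrunk copy of the larger could destroy this, and the order in which
  weight is taken prevents it.\<close>

lemma shrink_laminar:
  assumes C: "C \<in> cuts_of F' j" and D: "D \<in> cuts_of F' k" and x: "x \<in> C" "x \<in> D"
  shows "C \<subseteq> D \<or> D \<subseteq> C"
proof -
  have sub: "C \<subseteq> D" if C: "C \<in> cuts_of F' j" and D: "D \<in> cuts_of F' k"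
    and C0: "C0 \<in> cuts_of F j" and D0: "D0 \<in> cuts_of F k"
    and "C0 \<subset> D0" and "C = C0 \<or> 0 < K1 j C0 \<and> C = C0 - M" "D = D0 \<or> 0 < K1 k D0 \<and> D = D0 - M"
     "C = C0 \<Longrightarrow> K1 j C < F j C" for C D C0 D0 j k
  proof (cases "C = C0 \<and> 0 < K1 k D0 \<and> r \<in> C0")
    \<comment> \<open>The critical case is impossible: \<open>C\<close> precedes \<open>D0\<close>,
      so all its weight would have been taken, against \<open>K1 j C < F j C\<close>.\<close>
    case True
    then have "Defs.inner F tie (j, C) (k, D0)" using that by (auto simp: Defs.inner_def)
    then show ?thesis
      using innermost1_inner[OF fam todo _ C0, of r k D0] True that(8) by fastforce
  next
    case False
    then have "D \<noteq> D0 \<Longrightarrow> C = C0 \<Longrightarrow> C \<inter> M = {}" using that mem_meta[OF _ C0] by blast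
    then show ?thesis using that by blast
  qed
  have form: "\<exists>C0. C0 \<in> cuts_of F j \<and> (C = C0 \<or> 0 < K1 j C0 \<and> C = C0 - M) \<and> (C = C0 \<longrightarrow> K1 j C < F j C)"
    if "C \<in> cuts_of F' j" for C j
    using that
  proof (cases rule: shrink_cutE)
    case (shrunk C0)
    then have "C \<noteq> C0" using meta_refl by blast
    then show ?thesis using shrunk by blast
  qed blast
  obtain C0 where C0: "C0 \<in> cuts_of F j" "C = C0 \<or> 0 < K1 j C0 \<and> C = C0 - M" "C = C0 \<Longrightarrow> K1 j C < F j C"
    using form[OF C] by blast
  obtain D0 where D0: "D0 \<in> cuts_of F k" "D = D0 \<or> 0 < K1 k D0 \<and> D = D0 - M" "D = D0 \<Longrightarrow> K1 k D < F k D"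
    using form[OF D] by blast
  have "x \<in> C0" "x \<in> D0" using x C0(2) D0(2) by auto
  then have "C0 \<subseteq> D0 \<or> D0 \<subseteq> C0" using laminar[OF fam todo C0(1) D0(1)] by blast
  then consider "C0 \<subset> D0" | "D0 \<subset> C0" | "C0 = D0" by blast
  then show ?thesis
  proof cases
    case 1
    then show ?thesis using sub[OF C D C0(1) D0(1) 1 C0(2) D0(2) C0(3)] by blast
  next
    case 2
    then show ?thesis using sub[OF D C D0(1) C0(1) 2 D0(2) C0(2) D0(3)] by blast
  next
    case 3
    then show ?thesis using C0(2) D0(2) by blast
  qed
qed

lemma shrink_family: "frac_laminar_family P (T - {i}) F'"
  unfolding frac_laminar_family_iff
proof (intro conjI allI ballI impI)
  fix j assume j: "j \<in> T - {i}"
  have "(\<Sum>C\<in>cuts_of F' j. F' j C) = (\<Sum>C\<in>Pow (verts P). F' j C * 1)"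
    unfolding mult_1_right
  proof (rule sum.mono_neutral_left)
    show "cuts_of F' j \<subseteq> Pow (verts P)" using F_cutD(3) by (blast elim: shrink_origin)
    show "\<forall>C\<in>Pow (verts P) - cuts_of F' j. F' j C = 0"
      using shrink_nonneg[of j] by (auto simp: cuts_of_def order.antisym)
  qed (simp add: finite_verts)
  also have "\<dots> = 1" unfolding sum_shrink[OF j] using weight_1[OF fam todo, of j] j by simp
  finally show "(\<Sum>C\<in>cuts_of F' j. F' j C) = 1" .
next
  fix j C assume "C \<in> cuts_of F' j"
  then obtain D where D: "D \<in> cuts_of F j" "C \<subseteq> D" "loc P j \<in> C" by (elim shrink_origin)
  show "loc P j \<in> C" by (rule D(3))
  then show "is_cut P C" using F_cutD(2)[OF D(1)] D(2) by (auto simp: is_cut_def)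
next
  fix j k C D assume "C \<in> cuts_of F' j" "D \<in> cuts_of F' k"
  then show "C \<inter> D = {} \<or> C \<subseteq> D \<or> D \<subseteq> C" using shrink_laminar by blast
qed (auto simp: shrink_nonneg shrink_eq_0)

lemma shrink_inclusion: "inclusion_invariant P (T - {i}) tie F'"
  unfolding inclusion_invariant_def dominates_eq_prec
proof (intro ballI impI)
  fix j k C D
  assume jk: "j \<in> T - {i}" "k \<in> T - {i}" and "prec (outermost F') j k"
    and C: "C \<in> cuts_of F' j" and D: "D \<in> cuts_of F' k" and sub: "{loc P j, loc P k} \<subseteq> C \<inter> D"
  then have prec: "prec (outermost F) j k" by (simp add: prec_def outermost_shrink)
  show "C \<subseteq> D"
  proof (rule shrink_mono[OF C D])
    fix C0 D0 assume "C0 \<in> cuts_of F j" "D0 \<in> cuts_of F k" "C \<subseteq> C0" "D \<subseteq> D0"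
    then have "C0 \<subseteq> D0" using inclusion[OF prec] sub by blast
    then show "C0 \<subset> D0 \<or> C0 = D0 \<and> prec (outermost F) j k" using prec by blast
  qed
qed

lemma todo': "T - {i} \<subseteq> terminals P"
  using todo by blast

section \<open>How an iteration changes the two sides of an edge\<close>

abbreviation "only' \<equiv> only (T - {i}) F'"

lemma only_shrink:
  "only' u w = (\<Sum>j\<in>T - {i}. \<Sum>C\<in>Pow (verts P).
     (F j C - K1 j C) * of_bool (u \<in> C \<and> w \<notin> C) + K1 j C * of_bool (u \<in> C - M \<and> w \<notin> C - M))"
  unfolding only_def weighted_def by (rule sum.cong[OF refl]) (rule sum_shrink)

text \<open>Removing \<open>M\<close> does not affect how a cut separates two vertices outside it;
  only the cuts of \<open>i\<close> disappear.\<close>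

lemma only_shrink_outside:
  assumes "u \<notin> M" "w \<notin> M"
  shows "only' u w \<le> only T F u w"
proof -
  have "only' u w = (\<Sum>j\<in>T - {i}. \<Sum>C\<in>Pow (verts P). F j C * of_bool (u \<in> C \<and> w \<notin> C))"
    unfolding only_shrink using assms by (auto intro!: sum.cong simp: ring_distribs)
  also have "\<dots> \<le> only T F u w"
    unfolding only_def weighted_def
    by (rule sum_mono2) (auto simp: finite_T[OF fam todo] F_nonneg[OF fam todo] intro!: sum_nonneg)
  finally show ?thesis .
qed

lemma shrink_owner_outside:
  assumes "u \<notin> M" "w \<notin> M" "D \<in> cuts_of F' q" "u \<in> D" "w \<notin> D"
  obtains C where "C \<in> cuts_of F q" "u \<in> C" "w \<notin> C"
  using assms(3) by (rule shrink_origin) (use assms that in blast)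

context
  fixes u w
  assumes u: "u \<in> M" and w: "w \<notin> M"
begin

text \<open>Taken cuts contain \<open>u\<close>. Those avoiding \<open>w\<close> stop separating the
  edge, those containing \<open>w\<close> now separate it from the side of \<open>w\<close>. If the
  whole unit avoids \<open>w\<close>, the side of \<open>u\<close> loses 1; otherwise that side is
  used up.\<close>

lemma only_shrink_inside:
  "1 \<le> only T F u w \<and> only' u w \<le> only T F u w - 1 \<and> only' w u \<le> only T F w u \<or>
   only T F u w \<le> 1 \<and> only' u w = 0 \<and> only' w u \<le> only T F w u + 1 - only T F u w"
proof -
  \<comment> \<open>The taken unit splits into \<open>ka\<close>, avoiding \<open>w\<close>, and
    \<open>km\<close>, containing \<open>w\<close>.\<close>
  define ka where "ka = weighted T K1 (\<lambda>C. of_bool (w \<notin> C))"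
  define km where "km = weighted T K1 (\<lambda>C. of_bool (w \<in> C))"
  let ?a = "only T F u w"
  have K1_mem: "u \<in> C" if "K1 j C \<noteq> 0" for j C
    using that innermost1_posD(1,2)[OF fam todo, of r j C] mem_meta[OF u] by (auto simp: K1_pos_iff)
  have le: "K1 j C \<le> F j C" for j C by (rule innermost1_le[OF fam todo])
  have "ka + km = weighted T K1 (\<lambda>_. 1)"
    unfolding ka_def km_def weighted_add[symmetric] by (rule weighted_cong) simp
  then have total: "ka + km = 1" using innermost1_total[OF fam todo depth_ge_1] by simp
  have ka_eq: "ka = weighted T K1 (\<lambda>C. of_bool (u \<in> C \<and> w \<notin> C))"
    unfolding ka_def by (rule weighted_cong) (use K1_mem in auto)
  have nonneg: "0 \<le> ka" "0 \<le> km"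
    unfolding ka_def km_def by (auto intro!: weighted_nonneg simp: innermost1_nonneg)
  have "only' u w = (\<Sum>j\<in>T - {i}. \<Sum>C\<in>Pow (verts P). (F j C - K1 j C) * of_bool (u \<in> C \<and> w \<notin> C))"
    unfolding only_shrink using u by simp
  also have "\<dots> \<le> (\<Sum>j\<in>T. \<Sum>C\<in>Pow (verts P). (F j C - K1 j C) * of_bool (u \<in> C \<and> w \<notin> C))"
    by (rule sum_mono2) (auto simp: finite_T[OF fam todo] le intro!: sum_nonneg)
  also have "\<dots> = ?a - ka"
    unfolding ka_eq only_def weighted_def by (simp add: ring_distribs sum_subtractf)
  finally have uw: "only' u w \<le> ?a - ka" .
  have "only' w u = (\<Sum>j\<in>T - {i}. \<Sum>C\<in>Pow (verts P).
      F j C * of_bool (w \<in> C \<and> u \<notin> C) + K1 j C * of_bool (w \<in> C))"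
    unfolding only_shrink using u w K1_mem by (auto intro!: sum.cong)
  also have "\<dots> \<le> (\<Sum>j\<in>T. \<Sum>C\<in>Pow (verts P).
      F j C * of_bool (w \<in> C \<and> u \<notin> C) + K1 j C * of_bool (w \<in> C))"
    by (rule sum_mono2)
      (auto simp: finite_T[OF fam todo] F_nonneg[OF fam todo] innermost1_nonneg intro!: sum_nonneg)
  also have "\<dots> = only T F w u + km"
    unfolding km_def only_def weighted_def by (simp add: sum.distrib)
  finally have wu: "only' w u \<le> only T F w u + km" .
  have ka_le: "ka \<le> ?a"
    unfolding ka_eq only_def by (rule weighted_mono) (simp add: le)
  show ?thesis
  proof (cases "km = 0")
    case True
    then show ?thesis using total uw wu ka_le by simp
  next
    case False
    then obtain j C where jC: "K1 j C \<noteq> 0" "w \<in> C"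
      unfolding km_def
      using weighted_eq_0_iff[OF finite_T[OF fam todo], of K1 "\<lambda>C. of_bool (w \<in> C)"]
      by (auto simp: innermost1_nonneg)
    then have pos: "0 < K1 j C" by (simp add: K1_pos_iff)
    note C = innermost1_posD(1,2)[OF fam todo pos]
    \<comment> \<open>The taken cut \<open>C\<close> contains \<open>w\<close>; cuts around
      \<open>u\<close> that avoid \<open>w\<close> lie strictly inside it and are taken completely,
      so \<open>ka\<close> is all of \<open>only T F u w\<close>.\<close>
    have "K1 q D = F q D" if D: "D \<in> cuts_of F q" "u \<in> D" "w \<notin> D" for q D
    proof (rule innermost1_inner[OF fam todo pos D(1)])
      show "r \<in> D" using mem_meta[OF u D(1)] D(2) by blast
      then show "Defs.inner F tie (q, D) (j, C)"
        using laminar[OF fam todo D(1) C(1) _ C(2)] D(3) jC(2) by (auto simp: Defs.inner_def)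
    qed
    then have "ka = ?a"
      unfolding ka_eq only_def
    proof (intro weighted_cong)
      fix q D
      show "K1 q D * of_bool (u \<in> D \<and> w \<notin> D) = F q D * of_bool (u \<in> D \<and> w \<notin> D)"
        using \<open>\<And>q D. D \<in> cuts_of F q \<Longrightarrow> u \<in> D \<Longrightarrow> w \<notin> D \<Longrightarrow> K1 q D = F q D\<close>[of D q]
          F_eq_0[OF fam todo, of D q] le[of q D] innermost1_nonneg[of F tie r q D]
        by (cases "D \<in> cuts_of F q") auto
    qed
    then show ?thesis
      using uw wu nonneg total only_nonneg[OF shrink_family todo', of u w] by auto
  qed
qed

text \<open>No cut contained \<open>w\<close> without \<open>u\<close> before, so \<open>D\<close>
  arose by shrinking and its owner contributed to the innermost unit.\<close>

lemma new_cut_owner: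
  assumes nested: "only T F w u = 0" and D: "D \<in> cuts_of F' q" "w \<in> D" "u \<notin> D"
  shows "prec (outermost F) q i"
  using D(1)
proof (cases rule: shrink_cutE)
  case kept
  then show ?thesis using nested D unfolding only_eq_0_iff[OF fam todo] by blast
next
  case (shrunk C)
  then show ?thesis using K1_owner by blast
qed

text \<open>Some cut of \<open>i\<close> lies inside every cut around \<open>u\<close>, in
  particular inside one that avoids \<open>w\<close>.\<close>

lemma own_separating_cut:
  assumes "only T F u w \<noteq> 0"
  obtains C where "C \<in> cuts_of F i" "u \<in> C" "w \<notin> C"
proof -
  obtain q D where "D \<in> cuts_of F q" "u \<in> D" "w \<notin> D"
    using assms unfolding only_eq_0_iff[OF fam todo] by blast
  moreover obtain C where "C \<in> cuts_of F i" "\<And>j D. D \<in> cuts_of F j \<Longrightarrow> r \<in> D \<Longrightarrow> C \<subseteq> D"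
    using own_innermost_cut by blast
  ultimately show ?thesis using that mem_meta[OF u] F_cutD(4) by blast
qed

end

end

section \<open>The loop invariant\<close>

context round2
begin

text \<open>
  \<open>h\<close> collects the past pairs of a processed terminal and its meta-node at that time. If
  \<open>witness h Om F u w z\<close>, then every owner of a cut separating \<open>u\<close> from \<open>w\<close>
  dominates the last terminal that was processed on the side of \<open>z\<close>.
\<close>
definition witness ::
  "('t \<times> 'v set) set \<Rightarrow> ('t \<Rightarrow> 'v set) \<Rightarrow> ('v, 't) family \<Rightarrow> 'v \<Rightarrow> 'v \<Rightarrow> 'v \<Rightarrow> bool" where
  "witness h Om F u w z \<longleftrightarrow>
     (\<exists>x X. (x, X) \<in> h \<and> z \<in> X \<and> (\<forall>y Y. (y, Y) \<in> h \<longrightarrow> z \<in> Y \<longrightarrow> Y \<subseteq> X) \<and>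
       (\<forall>q. \<forall>C\<in>cuts_of F q. u \<in> C \<longrightarrow> w \<notin> C \<longrightarrow> prec Om q x))"

lemma witnessI:
  assumes "(x, X) \<in> h" "z \<in> X" "\<And>y Y. (y, Y) \<in> h \<Longrightarrow> z \<in> Y \<Longrightarrow> Y \<subseteq> X"
    "\<And>q C. C \<in> cuts_of F q \<Longrightarrow> u \<in> C \<Longrightarrow> w \<notin> C \<Longrightarrow> prec Om q x"
  shows "witness h Om F u w z"
  using assms unfolding witness_def by (intro exI[of _ x] exI[of _ X]) simp

lemma witnessE:
  assumes "witness h Om F u w z"
  obtains x X where "(x, X) \<in> h" "z \<in> X" "\<And>y Y. (y, Y) \<in> h \<Longrightarrow> z \<in> Y \<Longrightarrow> Y \<subseteq> X"
    "\<And>q C. C \<in> cuts_of F q \<Longrightarrow> u \<in> C \<Longrightarrow> w \<notin> C \<Longrightarrow> prec Om q x"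
  using assms unfolding witness_def by meson

text \<open>
  The three alternatives for \<open>l\<close> belong to edges that have seen one, two, and at least three steps,
  counted from the one that made them nested; the last of them was on the side of \<open>w\<close>.
\<close>
definition nested ::
  "('t \<times> 'v set) set \<Rightarrow> ('t \<Rightarrow> 'v set) \<Rightarrow> ('v, 't) state \<Rightarrow> 'v \<Rightarrow> 'v \<Rightarrow> bool" where
  "nested h Om s u w \<longleftrightarrow>
     (let l = int_load P (cuts s) {u, w}; c = cap P {u, w}; F = fam s in
      only (todo s) F w u = 0 \<and> 0 < only (todo s) F u w \<and> only (todo s) F u w \<le> 1 \<and>
      (l \<le> c \<or> l \<le> c + 1 \<and> witness h Om F u w w \<or> witness h Om F u w w \<and> witness h Om F u w u))"

text \<open>The first phase of an edge. The strict bound leaves room for the step that makes the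
  edge nested, after which the integral load may be \<open>cap P e\<close>.\<close>

definition slack :: "('v, 't) state \<Rightarrow> 'v set \<Rightarrow> bool" where
  "slack s e \<longleftrightarrow> int_load P (cuts s) e < cap P e \<and>
     real (int_load P (cuts s) e) + frac_load P (fam s) e \<le> real (cap P e)"

end

text \<open>\<open>Om\<close> holds the outermost cuts, fixed throughout. By
  \<open>past_prec\<close>, a processed terminal dominates the unprocessed ones located in its
  meta-node of that time. An edge inside a meta-node is settled: its bound rises from
  \<open>cap P e + 2\<close> to \<open>cap P e + 3\<close> only when \<open>h\<close> records a
  meta-node containing it. All other edges are active, and \<open>Yset s\<close> consists of the
  active ones of load \<open>cap P e + 2\<close>.\<close>

locale loop_invariant = round2 P tie for P :: "('v, 't) mcp" and tie :: "'t rel" +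
  fixes s :: "('v, 't) state" and h :: "('t \<times> 'v set) set" and Om :: "'t \<Rightarrow> 'v set"
  assumes fam: "frac_laminar_family P (todo s) (fam s)"
    and todo: "todo s \<subseteq> terminals P"
    and incl: "inclusion_invariant P (todo s) tie (fam s)"
    and outer: "\<And>j. j \<in> todo s \<Longrightarrow> outermost (fam s) j = Om j"
    and hist_nonempty: "hist s \<noteq> []"
    and hist_0: "hist s ! 0 = (\<lambda>v. {v})"
    and hist_refl: "\<And>t v. t < length (hist s) \<Longrightarrow> v \<in> (hist s ! t) v"
    and hist_eq: "\<And>t v w. t < length (hist s) \<Longrightarrow> w \<in> (hist s ! t) v \<Longrightarrow> (hist s ! t) w = (hist s ! t) v"
    and hist_mono: "\<And>t t' v. t \<le> t' \<Longrightarrow> t' < length (hist s) \<Longrightarrow> (hist s ! t) v \<subseteq> (hist s ! t') v"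
    and respects: "\<And>j C v. C \<in> cuts_of (fam s) j \<Longrightarrow> v \<in> C \<Longrightarrow> meta s v \<subseteq> C"
    and past: "\<And>x X. (x, X) \<in> h \<Longrightarrow> \<exists>t<length (hist s). X = (hist s ! t) (loc P x)"
    and past_prec: "\<And>x X j. (x, X) \<in> h \<Longrightarrow> j \<in> todo s \<Longrightarrow> loc P j \<in> X \<Longrightarrow> prec Om x j"
    and cuts_dom: "dom (cuts s) = terminals P - todo s"
    and cuts_loc: "\<And>j A. cuts s j = Some A \<Longrightarrow> loc P j \<in> A \<and> A \<subseteq> Om j"
    and Y_edges: "Yset s \<subseteq> edges P"
    and settled: "\<And>e v. e \<in> edges P \<Longrightarrow> e \<subseteq> meta s v \<Longrightarrow>
      e \<notin> Yset s \<and> int_load P (cuts s) e \<le> cap P e + 3 \<and>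
      ((\<forall>x X. (x, X) \<in> h \<longrightarrow> \<not> e \<subseteq> X) \<longrightarrow> int_load P (cuts s) e \<le> cap P e + 2)"
    and active: "\<And>e. e \<in> edges P \<Longrightarrow> (\<And>v. \<not> e \<subseteq> meta s v) \<Longrightarrow>
      int_load P (cuts s) e \<le> cap P e + 2 \<and>
      (if e \<in> Yset s then int_load P (cuts s) e = cap P e + 2 else int_load P (cuts s) e \<le> cap P e + 1) \<and>
      (slack s e \<or> (\<exists>u w. e = {u, w} \<and> nested h Om s u w))"
begin

lemma meta_nth: "meta s = hist s ! (length (hist s) - 1)"
  using hist_nonempty by (simp add: meta_def last_conv_nth)

lemma last_less: "length (hist s) - 1 < length (hist s)"
  using hist_nonempty by simp

lemma meta_refl: "v \<in> meta s v"
  unfolding meta_nth by (rule hist_refl[OF last_less])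

lemma meta_eq: "w \<in> meta s v \<Longrightarrow> meta s w = meta s v"
  unfolding meta_nth by (rule hist_eq[OF last_less])

lemma hist_meta: "t < length (hist s) \<Longrightarrow> (hist s ! t) v \<subseteq> meta s v"
  unfolding meta_nth by (rule hist_mono) auto

lemma past_meta:
  assumes "(x, X) \<in> h" "u \<in> X"
  shows "X \<subseteq> meta s u"
  using past[OF assms(1)] hist_eq hist_meta assms(2) by metis

lemma iterationI: "selectable P tie s i \<Longrightarrow> iteration P tie s i"
  using fam todo incl respects meta_refl meta_eq by unfold_locales auto

context
  fixes i
  assumes selectable: "selectable P tie s i"
begin

interpretation iteration P tie s i
  by (rule iterationI[OF selectable])

section \<open>Conflict edges and the chosen cut\<close>

lemma prec_outer: "j \<in> T \<Longrightarrow> k \<in> T \<Longrightarrow> prec (outermost F) j k \<longleftrightarrow> prec Om j k"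
  by (simp add: prec_def outer)

text \<open>The load \<open>cap + 2\<close> of an edge in \<open>Yset s\<close> forces the nested
  phase with a witness \<open>x\<close> at \<open>u\<close>. As \<open>i\<close> owns a cut
  separating the edge, \<open>i\<close> dominates \<open>x\<close>; were \<open>r\<close> in the
  meta-node recorded for \<open>x\<close>, then \<open>x\<close> would dominate
  \<open>i\<close>.\<close>

lemma conflict_history:
  assumes "{u, w} \<in> conflict_edges P s i" "u \<in> M" "w \<notin> M"
  shows "\<exists>x X. (x, X) \<in> h \<and> u \<in> X" "\<And>x X. (x, X) \<in> h \<Longrightarrow> u \<in> X \<Longrightarrow> r \<notin> X"
proof -
  let ?e = "{u, w}"
  have e: "?e \<in> edges P" "?e \<in> Yset s" using assms Y_edges by (auto simp: conflict_edges_def)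
  have "\<not> ?e \<subseteq> meta s v" for v using settled e by blast
  then have act: "int_load P (cuts s) ?e = cap P ?e + 2"
    "slack s ?e \<or> (\<exists>a b. ?e = {a, b} \<and> nested h Om s a b)"
    using active[OF e(1)] e(2) by auto
  \<comment> \<open>A deepest end carries at least as much separating weight as the other end, which
    fixes the orientation.\<close>
  moreover have "\<not> nested h Om s w u"
    using only_le[OF assms(2), of w] by (auto simp: nested_def Let_def)
  ultimately have "nested h Om s u w" by (auto simp: slack_def doubleton_eq_iff insert_commute)
  then have "0 < only T F u w" and wit: "witness h Om F u w u"
    using act(1) by (auto simp: nested_def Let_def)
  then obtain C where C: "C \<in> cuts_of F i" "u \<in> C" "w \<notin> C"
    using own_separating_cut[OF assms(2,3)] by force
  obtain x X where X: "(x, X) \<in> h" "u \<in> X" "\<And>y Y. (y, Y) \<in> h \<Longrightarrow> u \<in> Y \<Longrightarrow> Y \<subseteq> X" "prec Om i x"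
    using wit C by (elim witnessE) metis
  then show "\<exists>x X. (x, X) \<in> h \<and> u \<in> X" by blast
  have "r \<notin> X" using past_prec[OF X(1) i_todo] X(4) prec_trans prec_irrefl by blast
  then show "r \<notin> Y" if "(y, Y) \<in> h" "u \<in> Y" for y Y using X(3) that by blast
qed

lemma conflict_vertE:
  assumes "u \<in> conflict_verts P s i"
  obtains w where "{u, w} \<in> conflict_edges P s i" "u \<in> M" "w \<notin> M"
proof -
  obtain e where e: "e \<in> conflict_edges P s i" "u \<in> e" "u \<in> M"
    using assms by (auto simp: conflict_verts_def)
  then obtain a b where "e = {a, b}" "a \<in> M" "b \<notin> M"
    by (auto simp: conflict_edges_def elim: delta_edgeE)
  then show ?thesis using that e by blast
qed

text \<open>If \<open>r\<close> were a conflict vertex, some recorded meta-node would contain it,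
  and none would.\<close>

lemma no_abort: "\<not> aborts P s i"
proof
  assume "aborts P s i"
  then have "r \<in> conflict_verts P s i" by (simp add: aborts_def)
  then obtain w where "{r, w} \<in> conflict_edges P s i" "r \<in> M" "w \<notin> M" by (rule conflict_vertE)
  then show False using conflict_history by blast
qed

lemma chosen_cut_exists: "\<exists>A. chosen_cut P s i A"
proof (cases "conflict_edges P s i = {}")
  case False
  then obtain e where e: "e \<in> conflict_edges P s i" by blast
  then obtain u v where "e = {u, v}" "u \<in> M" by (auto simp: conflict_edges_def elim: delta_edgeE)
  then have "u \<in> conflict_verts P s i" using e by (auto simp: conflict_verts_def)
  then have "\<exists>u\<in>conflict_verts P s i. \<forall>u'\<in>conflict_verts P s i. entry_time P s i u \<le> entry_time P s i u'"
    using ex_has_least_nat[of "\<lambda>u. u \<in> conflict_verts P s i" u "entry_time P s i"] by blast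
  then show ?thesis using False by (auto simp: chosen_cut_def)
qed (simp add: chosen_cut_def)

lemma chosen_cut_cases:
  assumes "chosen_cut P s i A"
  obtains (whole) "A = M" "conflict_edges P s i = {}"
  | (part) t u where "Suc t < length (hist s)" "A = (hist s ! t) r" "u \<in> (hist s ! Suc t) r"
    "u \<in> conflict_verts P s i" "\<And>u'. u' \<in> conflict_verts P s i \<Longrightarrow> u' \<notin> A"
proof (cases "conflict_edges P s i = {}")
  case True
  then show ?thesis using assms whole by (simp add: chosen_cut_def)
next
  case False
  let ?in = "\<lambda>u t. t < length (hist s) \<and> u \<in> (hist s ! t) r"
  obtain u where u: "u \<in> conflict_verts P s i" "A = (hist s ! (entry_time P s i u - 1)) r"
    "\<And>u'. u' \<in> conflict_verts P s i \<Longrightarrow> entry_time P s i u \<le> entry_time P s i u'"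
    using assms False by (auto simp: chosen_cut_def)
  have "u \<noteq> r" using u(1) no_abort False by (auto simp: aborts_def)
  have "?in u (length (hist s) - 1)"
    using u(1) last_less by (auto simp: conflict_verts_def meta_nth)
  then have entry: "?in u (entry_time P s i u)"
    unfolding entry_time_def by (rule LeastI)
  \<comment> \<open>At time 0 the meta-node is \<open>{r}\<close>, and \<open>u\<close> differs from
    \<open>r\<close> since there is no abort; so subtracting 1 in \<open>chosen_cut\<close> gives a
    genuine earlier time.\<close>
  then have "entry_time P s i u \<noteq> 0" using \<open>u \<noteq> r\<close> hist_0 by (metis singletonD)
  then obtain t where t: "entry_time P s i u = Suc t" by (metis not0_implies_Suc)
  have "u' \<notin> A" if "u' \<in> conflict_verts P s i" for u'
  proof
    assume "u' \<in> A"
    then have "entry_time P s i u' \<le> t"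
      unfolding entry_time_def using entry t u(2) by (intro Least_le) simp
    then show False using u(3)[OF that] t by simp
  qed
  then show ?thesis using part[of t u] entry t u(1,2) by simp
qed

context
  fixes A
  assumes chosen: "chosen_cut P s i A"
begin

lemma chosen_loc: "r \<in> A" and chosen_subset: "A \<subseteq> M"
proof -
  show "r \<in> A"
    using chosen by (cases rule: chosen_cut_cases) (auto intro: meta_refl hist_refl)
  show "A \<subseteq> M"
    using chosen by (cases rule: chosen_cut_cases) (auto dest: subsetD[OF hist_meta, rotated])
qed

text \<open>The inner end of a conflict edge is not yet in the meta-node chosen as \<open>A\<close>,
  and the outer end is not even in \<open>M\<close>.\<close>

lemma chosen_avoids_conflicts:
  assumes "e \<in> conflict_edges P s i"
  shows "e \<notin> delta P A"
proof -
  obtain a b where e: "e = {a, b}" "a \<in> M" "b \<notin> M" "{a, b} \<in> edges P"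
    using assms by (auto simp: conflict_edges_def elim: delta_edgeE)
  then have a: "a \<in> conflict_verts P s i" using assms by (auto simp: conflict_verts_def)
  have "a \<notin> A" using chosen by (cases rule: chosen_cut_cases) (use a assms in auto)
  then show ?thesis using e chosen_subset mem_delta_iff by blast
qed

text \<open>Once settled, an edge is cut at most once: a recorded meta-node containing
  \<open>e\<close> would be later than \<open>A\<close>, hence contain \<open>r\<close> and the
  conflict vertex that joined right after \<open>A\<close>, against
  \<open>conflict_history\<close>.\<close>

lemma settled_cut_once:
  assumes e: "e \<subseteq> meta s v" "e \<in> delta P A"
  shows "e \<subseteq> M" "(x, X) \<in> h \<Longrightarrow> \<not> e \<subseteq> X"
proof -
  obtain a b where ab: "e = {a, b}" "a \<in> A" "b \<notin> A" using e(2) by (rule delta_edgeE)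
  then have "meta s a = M" "meta s a = meta s v" using e(1) chosen_subset meta_eq by auto
  then show eM: "e \<subseteq> M" using e(1) by simp
  show "\<not> e \<subseteq> X" if X: "(x, X) \<in> h"
    using chosen
  proof (cases rule: chosen_cut_cases)
    case whole
    then show ?thesis using eM ab by blast
  next
    case (part t u)
    show ?thesis
    proof
      assume "e \<subseteq> X"
      obtain k where k: "k < length (hist s)" "X = (hist s ! k) (loc P x)" using past[OF X] by blast
      then have Xa: "(hist s ! k) a = X" using hist_eq \<open>e \<subseteq> X\<close> ab(1) by blast
      have ta: "(hist s ! t) a = A" using hist_eq part(1,2) ab(2) by simp
      \<comment> \<open>Otherwise \<open>X\<close> would be contained in \<open>A\<close>, which
        misses \<open>b\<close>.\<close>
      have "\<not> k \<le> t" using hist_mono[of k t a] part(1) Xa ta \<open>e \<subseteq> X\<close> ab by auto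
      then have kt: "t \<le> k" "Suc t \<le> k" by auto
      have "r \<in> X" using hist_mono[OF kt(1) k(1), of a] chosen_loc Xa ta by blast
      then have "(hist s ! k) r = X" using hist_eq k by blast
      then have "u \<in> X" using hist_mono[OF kt(2) k(1), of r] part(3) by blast
      then show False
        using conflict_vertE[OF part(4)] conflict_history(2)[OF _ _ _ X] \<open>r \<in> X\<close> by metis
    qed
  qed
qed

section \<open>The state after the iteration\<close>

abbreviation "s' \<equiv> iterate P tie s i A"
abbreviation "h' \<equiv> insert (i, M) h"
abbreviation "M' \<equiv> merge P F' (meta s)"

lemma iterate_sel:
  "fam s' = F'" "todo s' = T - {i}" "cuts s' = (cuts s)(i \<mapsto> A)" "hist s' = hist s @ [M']"
  "meta s' = M'"
  by (simp_all add: iterate_def Let_def meta_def)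

lemma load_eq': "{u, w} \<in> edges P \<Longrightarrow> frac_load P F' {u, w} = only' u w + only' w u"
  by (rule load_eq[OF shrink_family todo'])

lemma merge_refl: "v \<in> M' v"
  by (simp add: merge_def)

lemma meta_subset_merge: "meta s v \<subseteq> M' v"
  by (auto simp: merge_def)

lemma merge_eq: "w \<in> M' v \<Longrightarrow> M' w = M' v"
proof -
  let ?R = "{(x, y). y \<in> meta s x \<or> {x, y} \<in> edges P \<and> frac_load P F' {x, y} = 0}"
  assume w: "w \<in> M' v"
  have "sym ?R" using meta_eq meta_refl by (auto simp: sym_def insert_commute)
  then have "sym (?R\<^sup>*)" by (rule sym_rtrancl)
  then have "(w, v) \<in> ?R\<^sup>*" using w by (auto simp: merge_def dest: symD)
  then show ?thesis using w by (auto simp: merge_def intro: rtrancl_trans)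
qed

text \<open>No cut separates the ends of an edge of load 0 or two vertices of an old meta-node;
  induction along a path does the rest.\<close>

lemma merge_respects:
  assumes C: "C \<in> cuts_of F' j" "v \<in> C"
  shows "M' v \<subseteq> C"
proof
  fix w assume "w \<in> M' v"
  then have "(v, w) \<in> {(x, y). y \<in> meta s x \<or> {x, y} \<in> edges P \<and> frac_load P F' {x, y} = 0}\<^sup>*"
    by (simp add: merge_def)
  then show "w \<in> C"
  proof induction
    case base
    show ?case by (rule C(2))
  next
    case (step y z)
    show ?case
    proof (cases "z \<in> meta s y")
      case True
      then show ?thesis using shrink_respects[OF C(1) step.IH] by blast
    next
      case False
      then have yz: "{y, z} \<in> edges P" "frac_load P F' {y, z} = 0" using step.hyps(2) by auto
      have "only' y z = 0"
        using load_eq'[OF yz(1)] yz(2) only_nonneg[OF shrink_family todo', of y z]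
          only_nonneg[OF shrink_family todo', of z y] by simp
      then show ?thesis using only_eq_0_iff[OF shrink_family todo'] C(1) step.IH by blast
    qed
  qed
qed

text \<open>Vertices of one meta-node lie in the same cuts, so an edge swallowed through
  contractions of other edges has load 0 too.\<close>

lemma settled_iff:
  assumes e: "e \<in> edges P"
  shows "(\<exists>v. e \<subseteq> M' v) \<longleftrightarrow> frac_load P F' e = 0"
proof -
  obtain u w where uw: "e = {u, w}" using e by (elim edgeE)
  show ?thesis
  proof
    assume "\<exists>v. e \<subseteq> M' v"
    then have "M' u = M' w" "w \<in> M' u" "u \<in> M' w" using uw merge_eq merge_refl by auto
    then have "only' u w = 0" "only' w u = 0"
      unfolding only_eq_0_iff[OF shrink_family todo'] using merge_respects by blast+
    then show "frac_load P F' e = 0" using e uw load_eq' by simp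
  next
    assume "frac_load P F' e = 0"
    then have "w \<in> M' u" using e uw by (auto simp: merge_def intro!: r_into_rtrancl)
    then show "\<exists>v. e \<subseteq> M' v" using uw merge_refl by blast
  qed
qed

lemma int_load_iterate:
  "int_load P (cuts s') e = int_load P (cuts s) e + (if e \<in> delta P A then 1 else 0)"
proof -
  let ?S = "{j \<in> dom (cuts s). e \<in> delta P (the (cuts s j))}"
  have i: "i \<notin> dom (cuts s)" using cuts_dom i_todo by blast
  have "finite ?S" using cuts_dom finite_terminals by (auto intro: finite_subset)
  moreover have "{j \<in> dom (cuts s'). e \<in> delta P (the (cuts s' j))} =
      (if e \<in> delta P A then insert i ?S else ?S)"
    using i by (auto simp: iterate_sel)
  ultimately show ?thesis using i by (simp add: int_load_def)
qed

lemma incident_if_cut: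
  assumes "e \<in> delta P A" "\<And>v. \<not> e \<subseteq> meta s v"
  shows "e \<in> delta P M"
proof -
  obtain a b where ab: "e = {a, b}" "a \<in> A" "b \<notin> A" "{a, b} \<in> edges P"
    using assms(1) by (rule delta_edgeE)
  then show ?thesis using assms(2)[of r] chosen_subset mem_delta_iff by blast
qed

text \<open>\<open>A\<close> avoids the edges of \<open>Yset s\<close>; any other active edge starts
  from at most \<open>cap P e + 1\<close>.\<close>

lemma active_load:
  assumes "e \<in> edges P" "\<And>v. \<not> e \<subseteq> meta s v"
  shows "if e \<in> Yset s then int_load P (cuts s') e = cap P e + 2 else int_load P (cuts s') e \<le> cap P e + 2"
proof (cases "e \<in> Yset s \<and> e \<in> delta P A")
  case True
  then have "e \<in> conflict_edges P s i" using incident_if_cut assms(2) by (auto simp: conflict_edges_def)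
  then show ?thesis using chosen_avoids_conflicts True by blast
next
  case False
  then show ?thesis using active[OF assms] by (auto simp: int_load_iterate)
qed

text \<open>Every owner of a separating cut owned one before, and \<open>M\<close> does not contain
  \<open>z\<close>, so the largest meta-node recorded around \<open>z\<close> is unchanged.\<close>

lemma witness_outside:
  assumes "witness h Om F u w z" "u \<notin> M" "w \<notin> M" "z = u \<or> z = w"
  shows "witness h' Om F' u w z"
proof -
  obtain x X where X: "(x, X) \<in> h" "z \<in> X" "\<And>y Y. (y, Y) \<in> h \<Longrightarrow> z \<in> Y \<Longrightarrow> Y \<subseteq> X"
    "\<And>q C. C \<in> cuts_of F q \<Longrightarrow> u \<in> C \<Longrightarrow> w \<notin> C \<Longrightarrow> prec Om q x"
    using assms(1) by (rule witnessE) blast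
  show ?thesis
  proof (rule witnessI)
    show "(x, X) \<in> h'" using X(1) by simp
    show "prec Om q x" if D: "D \<in> cuts_of F' q" "u \<in> D" "w \<notin> D" for q D
      using shrink_owner_outside[OF assms(2,3) D] X(4) by metis
    show "Y \<subseteq> X" if "(y, Y) \<in> h'" "z \<in> Y" for y Y
      using that X(3) assms(2-4) by auto
  qed (rule X(2))
qed

lemma nested_outside:
  assumes e: "{u, w} \<in> edges P" "u \<notin> M" "w \<notin> M"
    and nested: "nested h Om s u w" and load: "frac_load P F' {u, w} \<noteq> 0"
  shows "nested h' Om s' u w"
proof -
  have "{u, w} \<notin> delta P A" using e mem_delta_iff chosen_subset by blast
  then have "int_load P (cuts s') {u, w} = int_load P (cuts s) {u, w}" by (simp add: int_load_iterate)
  moreover have "only' w u = 0" "only' u w \<le> 1" "0 < only' u w"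
    using nested load load_eq'[OF e(1)] only_shrink_outside[OF e(2,3)] only_shrink_outside[OF e(3,2)]
      only_nonneg[OF shrink_family todo', of u w] only_nonneg[OF shrink_family todo', of w u]
    by (auto simp: nested_def Let_def)
  ultimately show ?thesis
    using nested witness_outside[OF _ e(2,3)] by (auto simp: nested_def Let_def iterate_sel)
qed

lemma slack_outside:
  assumes e: "{u, w} \<in> edges P" "u \<notin> M" "w \<notin> M" and slack: "slack s {u, w}"
  shows "slack s' {u, w}"
proof -
  have "{u, w} \<notin> delta P A" using e mem_delta_iff chosen_subset by blast
  then have "int_load P (cuts s') {u, w} = int_load P (cuts s) {u, w}" by (simp add: int_load_iterate)
  moreover have "frac_load P F' {u, w} \<le> frac_load P F {u, w}"
    unfolding load_eq'[OF e(1)] load_eq[OF fam todo e(1)]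
    using only_shrink_outside[OF e(2,3)] only_shrink_outside[OF e(3,2)] by simp
  ultimately show ?thesis using slack by (simp add: slack_def iterate_sel)
qed

section \<open>Edges with exactly one end in the selected meta-node\<close>

context
  fixes u w
  assumes u: "u \<in> M" and w: "w \<notin> M" and e: "{u, w} \<in> edges P"
    and load: "frac_load P F' {u, w} \<noteq> 0"
begin

lemma int_load_le_Suc: "int_load P (cuts s') {u, w} \<le> int_load P (cuts s) {u, w} + 1"
  by (simp add: int_load_iterate)

lemma load_pos: "0 < only' u w + only' w u"
  using load load_eq'[OF e] only_nonneg[OF shrink_family todo', of u w]
    only_nonneg[OF shrink_family todo', of w u] by simp

text \<open>If a full unit separates the ends, the loss in fractional load pays for the new integral
  cut, and the positive remainder keeps the integral load below capacity. Otherwise the edge becomes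
  nested, now seen from \<open>w\<close>.\<close>

lemma slack_inside:
  assumes "slack s {u, w}"
  shows "slack s' {u, w} \<or> nested h' Om s' w u"
  using only_shrink_inside[OF u w]
proof
  assume "1 \<le> only T F u w \<and> only' u w \<le> only T F u w - 1 \<and> only' w u \<le> only T F w u"
  then have "slack s' {u, w}"
    using assms int_load_le_Suc load_pos unfolding slack_def iterate_sel load_eq'[OF e] load_eq[OF fam todo e]
    by linarith
  then show ?thesis ..
next
  assume "only T F u w \<le> 1 \<and> only' u w = 0 \<and> only' w u \<le> only T F w u + 1 - only T F u w"
  \<comment> \<open>Maximal depth gives \<open>only T F w u \<le> only T F u w\<close>, hence the
    bound 1.\<close>
  then have "only' u w = 0" "only' w u \<le> 1" using only_le[OF u, of w] by auto
  moreover have "int_load P (cuts s') {u, w} \<le> cap P {u, w}"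
    using assms int_load_le_Suc by (simp add: slack_def)
  ultimately have "nested h' Om s' w u"
    using load_pos by (simp add: nested_def Let_def iterate_sel insert_commute)
  then show ?thesis ..
qed

text \<open>The terminal just processed is the witness on its own side: \<open>M\<close> is the
  largest meta-node recorded around \<open>u\<close>, and all separating cuts were created by this
  step.\<close>

lemma witness_new:
  assumes "only T F w u = 0"
  shows "witness h' Om F' w u u"
proof -
  show ?thesis
  proof (rule witnessI)
    show "(i, M) \<in> h'" by simp
    show "prec Om q i" if D: "D \<in> cuts_of F' q" "w \<in> D" "u \<notin> D" for q D
    proof -
      have "q \<in> T" using D(1) by (rule shrink_origin)
      then show ?thesis using new_cut_owner[OF u w assms D] prec_outer i_todo by blast
    qed
    show "Y \<subseteq> M" if "(y, Y) \<in> h'" "u \<in> Y" for y Y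
      using that past_meta[of y Y u] meta_eq[OF u] by auto
  qed (rule u)
qed

text \<open>The witness on the other side persists by transitivity: owners of new cuts dominate
  \<open>i\<close>, and \<open>i\<close>, owning a cut that separated the edge, dominates the old
  witness.\<close>

lemma witness_old:
  assumes only: "only T F w u = 0" "0 < only T F u w" and wit: "witness h Om F u w w"
  shows "witness h' Om F' w u w"
proof -
  obtain C where C: "C \<in> cuts_of F i" "u \<in> C" "w \<notin> C"
    using own_separating_cut[OF u w] only(2) by force
  obtain x X where X: "(x, X) \<in> h" "w \<in> X" "\<And>y Y. (y, Y) \<in> h \<Longrightarrow> w \<in> Y \<Longrightarrow> Y \<subseteq> X" "prec Om i x"
    using wit C by (elim witnessE) metis
  show ?thesis
  proof (rule witnessI)
    show "(x, X) \<in> h'" using X(1) by simp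
    show "prec Om q x" if D: "D \<in> cuts_of F' q" "w \<in> D" "u \<notin> D" for q D
    proof -
      have "q \<in> T" using D(1) by (rule shrink_origin)
      then have "prec Om q i" using new_cut_owner[OF u w only(1) D] prec_outer i_todo by blast
      then show ?thesis using X(4) prec_trans by blast
    qed
    show "Y \<subseteq> X" if "(y, Y) \<in> h'" "w \<in> Y" for y Y
      using that X(3) w by auto
  qed (rule X(2))
qed

text \<open>The orientation flips, the integral load grows by at most 1, and the step supplies a
  witness on the side of \<open>u\<close>; so the alternatives in \<open>nested\<close> advance by
  one.\<close>

lemma nested_inside:
  assumes "nested h Om s u w"
  shows "nested h' Om s' w u"
proof -
  have only: "only T F w u = 0" "0 < only T F u w" "only T F u w \<le> 1"
    using assms by (auto simp: nested_def Let_def)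
  have "only' u w = 0" "only' w u \<le> 1"
    using only_shrink_inside[OF u w] only load_pos by auto
  moreover have "0 < only' w u" using load_pos calculation by simp
  moreover have "witness h' Om F' w u u" by (rule witness_new[OF only(1)])
  moreover have "witness h Om F u w w \<Longrightarrow> witness h' Om F' w u w" by (rule witness_old[OF only(1,2)])
  ultimately show ?thesis
    using assms int_load_le_Suc by (auto simp: nested_def Let_def iterate_sel insert_commute)
qed

lemma not_nested_inside: "\<not> nested h Om s w u"
  using only_le[OF u, of w] by (auto simp: nested_def Let_def)

end

lemma active_iterate:
  assumes e: "e \<in> edges P" and act: "\<And>v. \<not> e \<subseteq> M' v"
  shows "slack s' e \<or> (\<exists>u w. e = {u, w} \<and> nested h' Om s' u w)"
proof -
  have load: "frac_load P F' e \<noteq> 0" using settled_iff[OF e] act by blast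
  have act': "\<not> e \<subseteq> meta s v" for v using act meta_subset_merge by blast
  then have inv: "slack s e \<or> (\<exists>u w. e = {u, w} \<and> nested h Om s u w)" using active[OF e] by blast
  show ?thesis
  proof (cases "e \<inter> M = {}")
    case True
    obtain u w where "e = {u, w}" using e by (elim edgeE)
    then have "slack s e \<Longrightarrow> slack s' e" using True e slack_outside by blast
    moreover have "nested h' Om s' u w" if "e = {u, w}" "nested h Om s u w" for u w
      using nested_outside[of u w] that e load True by blast
    ultimately show ?thesis using inv by blast
  next
    case False
    obtain a b where "e = {a, b}" using e by (elim edgeE)
    then obtain u w where uw: "e = {u, w}" "u \<in> M" "w \<notin> M"
      using False act'[of r] by (metis Int_emptyI insert_commute insert_iff empty_subsetI insert_subset singletonD)
    note inside = uw(2,3) e[unfolded uw(1)] load[unfolded uw(1)]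
    have "nested h Om s u w \<or> nested h Om s w u" if "e = {x, y}" "nested h Om s x y" for x y
      using that uw by (auto simp: doubleton_eq_iff)
    then have "slack s e \<or> nested h Om s u w" using inv not_nested_inside[OF inside] by blast
    then show ?thesis
      using slack_inside[OF inside] nested_inside[OF inside] uw(1) by (metis insert_commute)
  qed
qed

lemma invariant_iterate: "loop_invariant P tie s' h' Om"
proof (unfold_locales, unfold iterate_sel)
  show "frac_laminar_family P (T - {i}) F'" by (rule shrink_family)
  show "T - {i} \<subseteq> terminals P" by (rule todo')
  show "inclusion_invariant P (T - {i}) tie F'" by (rule shrink_inclusion)
  show "outermost F' j = Om j" if "j \<in> T - {i}" for j
    using that outer by (simp add: outermost_shrink)
  show "hist s @ [M'] \<noteq> []" by simp
  show "(hist s @ [M']) ! 0 = (\<lambda>v. {v})" using hist_nonempty hist_0 by (simp add: nth_append)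
  show "v \<in> ((hist s @ [M']) ! t) v" if "t < length (hist s @ [M'])" for t v
    using that hist_refl merge_refl by (simp add: nth_append)
  show "((hist s @ [M']) ! t) w = ((hist s @ [M']) ! t) v"
    if "t < length (hist s @ [M'])" "w \<in> ((hist s @ [M']) ! t) v" for t v w
  proof (cases "t < length (hist s)")
    case True
    then show ?thesis using that(2) hist_eq[OF True] by (simp add: nth_append)
  next
    case False
    then show ?thesis using that merge_eq by (simp add: nth_append)
  qed
  show "((hist s @ [M']) ! t) v \<subseteq> ((hist s @ [M']) ! t') v"
    if "t \<le> t'" "t' < length (hist s @ [M'])" for t t' v
  proof (cases "t' < length (hist s)")
    case True
    then show ?thesis using that hist_mono by (simp add: nth_append)
  next
    case False
    then have "t' = length (hist s)" using that by simp
    then show ?thesis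
      using that(1) hist_meta[of t v] meta_subset_merge[of v]
      by (cases "t = t'") (auto simp: nth_append)
  qed
  show "M' v \<subseteq> C" if "C \<in> cuts_of F' j" "v \<in> C" for j C v
    using that by (rule merge_respects)
  show "\<exists>t<length (hist s @ [M']). X = ((hist s @ [M']) ! t) (loc P x)" if "(x, X) \<in> h'" for x X
  proof (cases "(x, X) \<in> h")
    case True
    then obtain t where "t < length (hist s)" "X = (hist s ! t) (loc P x)" using past by blast
    then show ?thesis by (intro exI[of _ t]) (simp add: nth_append)
  next
    case False
    then show ?thesis
      using that last_less by (intro exI[of _ "length (hist s) - 1"]) (simp add: nth_append meta_nth)
  qed
  show "prec Om x j" if "(x, X) \<in> h'" "j \<in> T - {i}" "loc P j \<in> X" for x X j
    using that past_prec same_meta_dominated[of j] prec_outer[OF i_todo] by blast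
  show "dom ((cuts s)(i \<mapsto> A)) = terminals P - (T - {i})"
    using cuts_dom i_todo todo by auto
  show "loc P j \<in> B \<and> B \<subseteq> Om j" if "((cuts s)(i \<mapsto> A)) j = Some B" for j B
  proof (cases "j = i")
    case True
    \<comment> \<open>The outermost cut of \<open>i\<close> contains \<open>r\<close> and is a union
      of meta-nodes.\<close>
    have "M \<subseteq> Om i"
      using respects outermost_greatest(1)[OF fam todo i_todo] F_cutD(4) outer[OF i_todo] by metis
    then show ?thesis using True that chosen_loc chosen_subset by auto
  next
    case False
    then show ?thesis using that cuts_loc by simp
  qed
  show "Yset s' \<subseteq> edges P" using Y_edges by (auto simp: iterate_def Let_def)
next
  fix e v assume e: "e \<in> edges P" "e \<subseteq> M' v"
  have "e \<notin> Yset s'" using e settled_iff by (auto simp: iterate_def Let_def)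
  moreover have "int_load P (cuts s') e \<le> cap P e + 3 \<and>
    ((\<forall>x X. (x, X) \<in> h' \<longrightarrow> \<not> e \<subseteq> X) \<longrightarrow> int_load P (cuts s') e \<le> cap P e + 2)"
  proof (cases "\<exists>v. e \<subseteq> meta s v")
    case True
    then obtain v where v: "e \<subseteq> meta s v" by blast
    \<comment> \<open>If a settled edge is cut now, no recorded meta-node contained it, so its load
      was at most \<open>cap P e + 2\<close>. The new record \<open>(i, M)\<close> contains it, and
      only the bound \<open>cap P e + 3\<close> remains to be kept.\<close>
    show ?thesis
    proof (cases "e \<in> delta P A")
      case True
      then show ?thesis
        using settled[OF e(1) v] settled_cut_once[OF v True] by (auto simp: int_load_iterate)
    next
      case False
      then show ?thesis using settled[OF e(1) v] by (auto simp: int_load_iterate)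
    qed
  next
    \<comment> \<open>The edge was active until this iteration.\<close>
    case False
    then show ?thesis using active_load[OF e(1)] by (auto split: if_splits)
  qed
  ultimately show "e \<notin> Yset s' \<and> int_load P ((cuts s)(i \<mapsto> A)) e \<le> cap P e + 3 \<and>
    ((\<forall>x X. (x, X) \<in> h' \<longrightarrow> \<not> e \<subseteq> X) \<longrightarrow> int_load P ((cuts s)(i \<mapsto> A)) e \<le> cap P e + 2)"
    unfolding iterate_sel by blast
next
  fix e assume e: "e \<in> edges P" and act: "\<And>v. \<not> e \<subseteq> M' v"
  have load: "int_load P (cuts s') e \<le> cap P e + 2" "e \<in> Yset s \<Longrightarrow> int_load P (cuts s') e = cap P e + 2"
    using active_load[OF e] act meta_subset_merge by (metis order.trans order.refl)+
  obtain a b where ab: "e = {a, b}" using e by (elim edgeE)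
  \<comment> \<open>Load 0 would have settled the edge; with positive load it is not removed from
    \<open>Yset\<close>.\<close>
  have "0 < frac_load P F' e"
    using settled_iff[OF e] act load_eq'[OF e[unfolded ab]] ab
      only_nonneg[OF shrink_family todo', of a b] only_nonneg[OF shrink_family todo', of b a]
    by (metis add_nonneg_nonneg order_le_less)
  then have "e \<in> Yset s' \<longleftrightarrow> e \<in> Yset s \<or> int_load P (cuts s') e = cap P e + 2"
    using e by (auto simp: iterate_def Let_def)
  then show "int_load P ((cuts s)(i \<mapsto> A)) e \<le> cap P e + 2 \<and>
      (if e \<in> Yset s' then int_load P ((cuts s)(i \<mapsto> A)) e = cap P e + 2
       else int_load P ((cuts s)(i \<mapsto> A)) e \<le> cap P e + 1) \<and>
      (slack s' e \<or> (\<exists>u w. e = {u, w} \<and> nested h' Om s' u w))"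
    using load active_iterate[OF e act] unfolding iterate_sel by auto
qed

end

end

end

section \<open>Preprocessing\<close>

lemma sum_mult_of_bool_diff:
  fixes g :: "'a \<Rightarrow> real"
  assumes "finite S" "a \<in> S" "b \<in> S"
  shows "(\<Sum>x\<in>S. g x * (of_bool (x = a) - of_bool (x = b))) = g a - g b"
  using assms by (simp add: right_diff_distrib sum_subtractf of_bool_def if_distrib[of "(*) _"] cong: if_cong)

context round2
begin

text \<open>The requirements on preprocessing without the inclusion invariant.\<close>

definition reassigns :: "('v, 't) family \<Rightarrow> ('v, 't) family \<Rightarrow> bool" where
  "reassigns F G \<longleftrightarrow> frac_laminar_family P (terminals P) G \<and>
     (\<forall>C. (\<Sum>i\<in>terminals P. G i C) = (\<Sum>i\<in>terminals P. F i C)) \<and>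
     (\<forall>i\<in>terminals P. outermost G i \<subseteq> outermost F i)"

text \<open>A compact variant of \<open>reassigns\<close>: the bound on outermost cuts becomes a
  closed condition, vanishing outside \<open>Om i\<close>, and families are uncurried into points of
  a product space.\<close>

definition reassignments ::
  "('v, 't) family \<Rightarrow> ('t \<Rightarrow> 'v set) \<Rightarrow> ('t \<times> 'v set \<Rightarrow> real) set" where
  "reassignments F Om = {G. (\<forall>p. 0 \<le> G p) \<and>
     (\<forall>i C. \<not> (i \<in> terminals P \<and> loc P i \<in> C \<and> C \<subseteq> Om i) \<longrightarrow> G (i, C) = 0) \<and>
     (\<forall>C. (\<Sum>i\<in>terminals P. G (i, C)) = (\<Sum>i\<in>terminals P. F i C)) \<and>
     (\<forall>i\<in>terminals P. (\<Sum>C\<in>Pow (verts P). G (i, C)) = 1)}"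

context
  fixes F :: "('v, 't) family"
  assumes F: "frac_laminar_family P (terminals P) F"
begin

text \<open>Reassignment creates no new vertex sets; this is how laminarity is inherited from
  \<open>F\<close>.\<close>

lemma column_pos:
  assumes "\<And>k E. 0 \<le> G k E" "(\<Sum>i\<in>terminals P. G i C) = (\<Sum>i\<in>terminals P. F i C)"
    and "i \<in> terminals P" "0 < G i C"
  obtains j where "C \<in> cuts_of F j"
proof -
  have "0 < (\<Sum>i\<in>terminals P. G i C)"
    using assms finite_terminals by (intro sum_pos2[of _ i]) auto
  then have "(\<Sum>i\<in>terminals P. F i C) \<noteq> 0" using assms(2) by simp
  then obtain j where "F j C \<noteq> 0" using sum.neutral by metis
  then show ?thesis using that F_eq_0[OF F order.refl] by blast
qed

lemma reassignmentD:
  assumes G: "G \<in> reassignments F Om" and Om: "\<And>i. i \<in> terminals P \<Longrightarrow> Om i \<subseteq> outermost F i"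
  shows "reassigns F (curry G)" "i \<in> terminals P \<Longrightarrow> outermost (curry G) i \<subseteq> Om i"
proof -
  let ?G = "curry G"
  have nonneg: "0 \<le> ?G k E" for k E using G by (simp add: reassignments_def)
  have supp: "i \<in> terminals P \<and> loc P i \<in> C \<and> C \<subseteq> Om i" if "C \<in> cuts_of ?G i" for i C
  proof -
    have "\<not> (i \<in> terminals P \<and> loc P i \<in> C \<and> C \<subseteq> Om i) \<Longrightarrow> G (i, C) = 0"
      using G by (simp add: reassignments_def)
    then show ?thesis using that by (auto simp: cuts_of_def)
  qed
  have column: "(\<Sum>i\<in>terminals P. ?G i C) = (\<Sum>i\<in>terminals P. F i C)" for C
    using G by (simp add: reassignments_def)
  have F_cut: "\<exists>j. C \<in> cuts_of F j" if "C \<in> cuts_of ?G i" for i C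
  proof -
    have "i \<in> terminals P" "0 < ?G i C" using supp[OF that] that by (simp_all add: cuts_of_def)
    then show ?thesis using column_pos[of ?G C i, OF nonneg column] by blast
  qed
  have fam: "frac_laminar_family P (terminals P) ?G"
    unfolding frac_laminar_family_iff
  proof (intro conjI allI ballI impI)
    show "0 \<le> ?G i C" for i C by (rule nonneg)
    show "?G i C = 0" if "i \<notin> terminals P" for i C
      using G that by (simp add: reassignments_def)
    show "is_cut P C" if "C \<in> cuts_of ?G i" for i C
      using F_cut[OF that] cuts_ofD(2)[OF F order.refl] by blast
    show "loc P i \<in> C" if "C \<in> cuts_of ?G i" for i C
      using supp[OF that] by blast
    show "C \<inter> D = {} \<or> C \<subseteq> D \<or> D \<subseteq> C" if "C \<in> cuts_of ?G i" "D \<in> cuts_of ?G j" for i j C D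
      using F_cut[OF that(1)] F_cut[OF that(2)] laminar[OF F order.refl] by blast
    show "(\<Sum>C\<in>cuts_of ?G i. ?G i C) = 1" if i: "i \<in> terminals P" for i
    proof -
      have "(\<Sum>C\<in>cuts_of ?G i. ?G i C) = (\<Sum>C\<in>Pow (verts P). ?G i C)"
      proof (rule sum.mono_neutral_left)
        show "cuts_of ?G i \<subseteq> Pow (verts P)"
          using F_cut cuts_ofD(3)[OF F order.refl] by blast
        show "\<forall>C\<in>Pow (verts P) - cuts_of ?G i. ?G i C = 0"
          using nonneg[of i] by (auto simp: cuts_of_def order.antisym)
      qed (simp add: finite_verts)
      then show ?thesis using G i by (simp add: reassignments_def)
    qed
  qed
  show outer: "outermost ?G i \<subseteq> Om i" if "i \<in> terminals P" for i
    using supp outermost_greatest(1)[OF fam order.refl that] by blast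
  show "reassigns F ?G"
    unfolding reassigns_def using fam column outer Om by blast
qed

lemma reassignments_subset_box:
  assumes Om: "\<And>i. i \<in> terminals P \<Longrightarrow> Om i \<subseteq> verts P"
  shows "reassignments F Om \<subseteq> Pi\<^sub>E UNIV (\<lambda>_. {0..1})"
proof
  fix G assume G: "G \<in> reassignments F Om"
  have "G (i, C) \<le> 1" for i C
  proof (cases "i \<in> terminals P \<and> loc P i \<in> C \<and> C \<subseteq> Om i")
    case True
    then have "C \<in> Pow (verts P)" using Om by blast
    then have "G (i, C) \<le> (\<Sum>C\<in>Pow (verts P). G (i, C))"
      using G finite_verts by (intro member_le_sum) (auto simp: reassignments_def)
    then show ?thesis using G True by (simp add: reassignments_def)
  qed (use G in \<open>simp add: reassignments_def\<close>)
  then show "G \<in> Pi\<^sub>E UNIV (\<lambda>_. {0..1})" using G by (auto simp: reassignments_def)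
qed

text \<open>The set is closed in a product of unit intervals, which is compact by Tychonoff's
  theorem.\<close>

lemma compact_reassignments:
  assumes Om: "\<And>i. i \<in> terminals P \<Longrightarrow> Om i \<subseteq> verts P"
  shows "compact (reassignments F Om)"
proof -
  let ?T = "terminals P" and ?V = "Pow (verts P)"
  let ?box = "Pi\<^sub>E UNIV (\<lambda>_. {0..1}) :: ('t \<times> 'v set \<Rightarrow> real) set"
  have "compactin (product_topology (\<lambda>_. euclidean) UNIV) ?box"
    by (simp add: compactin_PiE)
  then have "compact ?box" by (simp add: euclidean_product_topology)
  moreover have "closed (reassignments F Om)"
  proof -
    have "reassignments F Om =
      (\<Inter>p. {G. 0 \<le> G p}) \<inter>
      (\<Inter>p\<in>{p. \<not> (fst p \<in> ?T \<and> loc P (fst p) \<in> snd p \<and> snd p \<subseteq> Om (fst p))}. {G. G p = 0}) \<inter>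
      (\<Inter>C. {G. (\<Sum>i\<in>?T. G (i, C)) = (\<Sum>i\<in>?T. F i C)}) \<inter>
      (\<Inter>i\<in>?T. {G. (\<Sum>C\<in>?V. G (i, C)) = 1})"
      by (simp add: reassignments_def set_eq_iff)
    moreover have "closed \<dots>"
      by (intro closed_Int closed_INT ballI)
        (auto intro!: closed_Collect_le closed_Collect_eq continuous_on_sum continuous_on_const
          continuous_on_product_coordinates)
    ultimately show ?thesis by simp
  qed
  ultimately have "compact (?box \<inter> reassignments F Om)" by (rule compact_Int_closed)
  then show ?thesis using reassignments_subset_box[OF Om] by (simp add: Int_absorb1)
qed

text \<open>Two extremal choices: minimising the total size of the outermost cuts freezes the
  dominance order; then a linear functional built from this order is maximised.\<close>

lemma preprocessed_exists: "\<exists>F'. preprocessed P tie F F'"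
proof -
  let ?T = "terminals P" and ?V = "Pow (verts P)"
  define size where "size G = (\<Sum>i\<in>?T. card (outermost G i))" for G :: "('v, 't) family"
  have "reassigns F F" using F by (simp add: reassigns_def)
  then obtain G0 where G0: "reassigns F G0" "\<And>G. reassigns F G \<Longrightarrow> size G0 \<le> size G"
    using ex_has_least_nat[of "reassigns F" F size] by blast
  define Om where "Om = outermost G0"
  have fam0: "frac_laminar_family P ?T G0"
    and Om_F: "i \<in> ?T \<Longrightarrow> Om i \<subseteq> outermost F i" for i
    using G0(1) by (auto simp: reassigns_def Om_def)
  have Om_V: "Om i \<subseteq> verts P" if "i \<in> ?T" for i
    using cuts_ofD(3)[OF fam0 order.refl outermost_greatest(1)[OF fam0 order.refl that]]
    by (simp add: Om_def)
  have reassigns: "reassigns F (curry G)" if "G \<in> reassignments F Om" for G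
    by (rule reassignmentD(1)[OF that]) (rule Om_F)
  have sub: "outermost (curry G) i \<subseteq> Om i" if "G \<in> reassignments F Om" "i \<in> ?T" for G i
    by (rule reassignmentD(2)[OF that(1) _ that(2)]) (rule Om_F)
  \<comment> \<open>A smaller outermost cut would contradict the minimal total size. So dominance is
    the same for all members of \<open>reassignments F Om\<close>.\<close>
  have outer: "outermost (curry G) i = Om i" if G: "G \<in> reassignments F Om" and i: "i \<in> ?T" for G i
  proof (rule ccontr)
    assume "outermost (curry G) i \<noteq> Om i"
    then have "outermost (curry G) i \<subset> Om i" using sub[OF G i] by blast
    then have "card (outermost (curry G) i) < card (Om i)"
      using Om_V[OF i] finite_verts by (meson psubset_card_mono finite_subset)
    moreover have "card (outermost (curry G) j) \<le> card (Om j)" if "j \<in> ?T" for j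
      using sub[OF G that] Om_V[OF that] finite_verts by (meson card_mono finite_subset)
    ultimately have "size (curry G) < size G0"
      unfolding size_def Om_def using i finite_terminals by (intro sum_strict_mono_ex1) auto
    then show False using G0(2)[OF reassigns[OF G]] by simp
  qed
  \<comment> \<open>The rank in the dominance order, used in \<open>\<Phi>\<close> to reward large
    cuts of dominated terminals.\<close>
  define rk where "rk i = card {k \<in> ?T. prec Om k i}" for i
  have rk: "rk i < rk j" if "i \<in> ?T" "prec Om i j" for i j
    unfolding rk_def
  proof (rule psubset_card_mono)
    have "i \<in> {k \<in> ?T. prec Om k j} - {k \<in> ?T. prec Om k i}" using that prec_irrefl by simp
    moreover have "{k \<in> ?T. prec Om k i} \<subseteq> {k \<in> ?T. prec Om k j}"
      using that(2) prec_trans by blast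
    ultimately show "{k \<in> ?T. prec Om k i} \<subset> {k \<in> ?T. prec Om k j}" by blast
  qed (simp add: finite_terminals)
  define \<Phi> where "\<Phi> G = (\<Sum>i\<in>?T. \<Sum>C\<in>?V. real (rk i) * real (card C) * G (i, C))" for G
  have "continuous_on (reassignments F Om) \<Phi>"
    unfolding \<Phi>_def
    by (intro continuous_on_sum continuous_on_mult continuous_on_const
        continuous_on_subset[OF continuous_on_product_coordinates] subset_UNIV)
  moreover have "(\<lambda>(i, C). G0 i C) \<in> reassignments F Om"
  proof -
    have "G0 i C = 0" if "\<not> (i \<in> ?T \<and> loc P i \<in> C \<and> C \<subseteq> Om i)" for i C
    proof (rule F_eq_0[OF fam0 order.refl], rule notI)
      assume C: "C \<in> cuts_of G0 i"
      note cuts_ofD(1,4)[OF fam0 order.refl C]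
      then show False
        using that outermost_greatest(2)[OF fam0 order.refl _ C] by (simp add: Om_def)
    qed
    then show ?thesis
      using G0(1) F_nonneg[OF fam0 order.refl] weight_1[OF fam0 order.refl]
      by (auto simp: reassignments_def reassigns_def)
  qed
  moreover have "compact (reassignments F Om)" by (rule compact_reassignments) (rule Om_V)
  ultimately obtain G where G: "G \<in> reassignments F Om"
    and max: "\<And>H. H \<in> reassignments F Om \<Longrightarrow> \<Phi> H \<le> \<Phi> G"
    using continuous_attains_sup[of "reassignments F Om" \<Phi>] by blast
  have fam: "frac_laminar_family P ?T (curry G)"
    using reassigns[OF G] by (simp add: reassigns_def)
  have "C \<subseteq> D" if ij: "i \<in> ?T" "j \<in> ?T" "prec Om i j"
    and C: "C \<in> cuts_of (curry G) i" and D: "D \<in> cuts_of (curry G) j"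
    and loc: "{loc P i, loc P j} \<subseteq> C \<inter> D" for i j C D
  proof (rule ccontr)
    assume "\<not> C \<subseteq> D"
    then have DC: "D \<subset> C" using laminar[OF fam order.refl C D] loc by blast
    have CV: "C \<in> ?V" "D \<in> ?V" using cuts_ofD(3)[OF fam order.refl] C D by auto
    \<comment> \<open>Both cuts may change owner: \<open>i\<close> dominates \<open>j\<close>, so
      \<open>Om i\<close> lies inside \<open>Om j\<close>.\<close>
    have "C \<subseteq> Om i" using outermost_greatest(2)[OF fam order.refl ij(1) C] outer[OF G ij(1)] by simp
    then have Om: "C \<subseteq> Om i" "D \<subseteq> Om i" "C \<subseteq> Om j" "D \<subseteq> Om j"
      using DC prec_subset[OF ij(3)] by auto
    have "i \<noteq> j" using ij(3) prec_irrefl by blast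
    define \<epsilon> where "\<epsilon> = min (G (i, C)) (G (j, D))"
    have \<epsilon>: "0 < \<epsilon>" "\<epsilon> \<le> G (i, C)" "\<epsilon> \<le> G (j, D)" using C D by (auto simp: \<epsilon>_def cuts_of_def)
    \<comment> \<open>The swap gives \<open>\<epsilon>\<close> of \<open>C\<close> from
      \<open>i\<close> to \<open>j\<close> and \<open>\<epsilon>\<close> of \<open>D\<close> from
      \<open>j\<close> to \<open>i\<close>. As \<open>\<sigma>\<close> and \<open>\<tau>\<close> sum
      to 0, the weight of each terminal and of each vertex set is preserved.\<close>
    define \<sigma> :: "'t \<Rightarrow> real" where "\<sigma> k = of_bool (k = j) - of_bool (k = i)" for k
    define \<tau> :: "'v set \<Rightarrow> real" where "\<tau> E = of_bool (E = C) - of_bool (E = D)" for E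
    define H where "H = (\<lambda>(k, E). G (k, E) + \<epsilon> * (\<sigma> k * \<tau> E))"
    have \<sigma>: "(\<Sum>k\<in>?T. g k * \<sigma> k) = g j - g i" for g
      unfolding \<sigma>_def by (rule sum_mult_of_bool_diff[OF finite_terminals ij(2,1)])
    have \<tau>: "(\<Sum>E\<in>?V. g E * \<tau> E) = g C - g D" for g
      unfolding \<tau>_def using finite_verts CV by (intro sum_mult_of_bool_diff) auto
    have \<sigma>0: "(\<Sum>k\<in>?T. \<sigma> k) = 0" and \<tau>0: "(\<Sum>E\<in>?V. \<tau> E) = 0"
      using \<sigma>[of "\<lambda>_. 1"] \<tau>[of "\<lambda>_. 1"] by simp_all
    have "H \<in> reassignments F Om"
      unfolding reassignments_def
    proof (intro CollectI conjI allI ballI impI)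
      show "0 \<le> H p" for p
        using G \<epsilon> \<open>i \<noteq> j\<close> DC by (cases p) (auto simp: H_def \<sigma>_def \<tau>_def reassignments_def)
      show "H (k, E) = 0" if "\<not> (k \<in> ?T \<and> loc P k \<in> E \<and> E \<subseteq> Om k)" for k E
      proof -
        have "\<sigma> k * \<tau> E = 0" using that ij Om loc by (auto simp: \<sigma>_def \<tau>_def)
        then show ?thesis using G that by (auto simp: H_def reassignments_def)
      qed
      show "(\<Sum>k\<in>?T. H (k, E)) = (\<Sum>k\<in>?T. F k E)" for E
        using G \<sigma>0 by (simp add: H_def reassignments_def sum.distrib flip: sum_distrib_left sum_distrib_right)
      show "(\<Sum>E\<in>?V. H (k, E)) = 1" if "k \<in> ?T" for k
        using G \<tau>0 that by (simp add: H_def reassignments_def sum.distrib flip: sum_distrib_left)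
    qed
    then have "\<Phi> H \<le> \<Phi> G" by (rule max)
    \<comment> \<open>The gain factors into the rank difference and the size difference, both
      positive.\<close>
    moreover have "\<Phi> H = \<Phi> G + \<epsilon> * ((real (rk j) - real (rk i)) * (real (card C) - real (card D)))"
    proof -
      have "(\<Sum>k\<in>?T. \<Sum>E\<in>?V. real (rk k) * real (card E) * (\<epsilon> * (\<sigma> k * \<tau> E))) =
          \<epsilon> * ((\<Sum>k\<in>?T. real (rk k) * \<sigma> k) * (\<Sum>E\<in>?V. real (card E) * \<tau> E))"
        unfolding sum_product by (simp add: sum_distrib_left mult_ac)
      then show ?thesis
        unfolding \<Phi>_def H_def \<sigma> \<tau> by (simp add: distrib_left sum.distrib)
    qed
    moreover have "card D < card C"
      using DC CV finite_verts by (meson PowD finite_subset psubset_card_mono)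
    ultimately show False
      using rk[OF ij(1,3)] \<epsilon>(1) by (simp add: mult_le_0_iff)
  qed
  then have "inclusion_invariant P ?T tie (curry G)"
    unfolding inclusion_invariant_def dominates_eq_prec prec_def
    using outer[OF G] by (metis prec_def)
  then have "preprocessed P tie F (curry G)"
    using reassigns[OF G] by (auto simp: preprocessed_def reassigns_def)
  then show ?thesis by blast
qed

text \<open>The load depends only on the total weight of each vertex set, which reassignment
  keeps.\<close>

lemma frac_load_preprocessed:
  assumes F': "preprocessed P tie F F'" and e: "e \<in> edges P"
  shows "frac_load P F' e = frac_load P F e"
proof -
  obtain u w where uw: "e = {u, w}" using e by (elim edgeE)
  have "weighted (terminals P) F' g = weighted (terminals P) F g" for g
  proof -
    have "weighted (terminals P) G g = (\<Sum>C\<in>Pow (verts P). (\<Sum>i\<in>terminals P. G i C) * g C)" for G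
      unfolding weighted_def sum_distrib_right by (rule sum.swap)
    then show ?thesis using F' by (simp add: preprocessed_def)
  qed
  moreover have "frac_laminar_family P (terminals P) F'" using F' by (simp add: preprocessed_def)
  ultimately show ?thesis
    using e F unfolding uw by (simp add: load_eq[OF _ order.refl] only_def)
qed

end

section \<open>Correctness of Round-2\<close>

text \<open>All edges start slack: the integral load is 0, below the positive capacity, and the
  fractional load is feasible. Singleton meta-nodes contain no edge.\<close>

lemma invariant_initial:
  assumes F: "frac_feasible P (cap P) F" and F': "preprocessed P tie F F'"
  shows "loop_invariant P tie (initial P F') {} (outermost F')"
proof -
  have fam: "frac_laminar_family P (terminals P) F" using F by (simp add: frac_feasible_def)
  have load: "frac_load P F' e \<le> real (cap P e)" if "e \<in> edges P" for e
    using that F frac_load_preprocessed[OF fam F' that] by (simp add: frac_feasible_def)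
  have no_loop: "\<not> e \<subseteq> {v}" if "e \<in> edges P" for e v
    using that by (elim edgeE) auto
  have sel: "fam (initial P F') = F'" "todo (initial P F') = terminals P" "cuts (initial P F') = Map.empty"
    "hist (initial P F') = [\<lambda>v. {v}]" "Yset (initial P F') = {}" "meta (initial P F') = (\<lambda>v. {v})"
    by (simp_all add: initial_def meta_def)
  have 0: "int_load P Map.empty e = 0" for e by (simp add: int_load_def)
  show ?thesis
    by (unfold_locales, unfold sel)
      (use F' load no_loop cap_pos in \<open>auto simp: preprocessed_def slack_def sel 0\<close>)
qed

lemma feasible_output:
  assumes F: "frac_feasible P (cap P) F" and F': "preprocessed P tie F F'"
    and inv: "loop_invariant P tie s h (outermost F')" and finished: "todo s = {}"
  shows "int_feasible P (\<lambda>e. cap P e + 3) (cuts s)"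
proof -
  interpret loop_invariant P tie s h "outermost F'" by (rule inv)
  have fam: "frac_laminar_family P (terminals P) F" using F by (simp add: frac_feasible_def)
  have fam': "frac_laminar_family P (terminals P) F'" using F' by (simp add: preprocessed_def)
  have dom: "dom (cuts s) = terminals P" using cuts_dom finished by simp
  have cut: "loc P i \<in> the (cuts s i)" "the (cuts s i) \<subseteq> outermost F' i" if "i \<in> terminals P" for i
    using that dom cuts_loc by (metis domD option.sel)+
  \<comment> \<open>Chosen cuts lie in outermost cuts of \<open>F'\<close>, and these in outermost
    cuts of \<open>F\<close>; so the separation within a commodity is inherited from
    \<open>F\<close>.\<close>
  have union: "the (cuts s i) \<subseteq> \<Union>(cuts_of F i)" if "i \<in> terminals P" for i
    using cut(2)[OF that] F' that outermost_greatest(1)[OF fam order.refl that]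
    unfolding preprocessed_def by blast
  show ?thesis
    unfolding int_feasible_def
  proof (intro conjI ballI impI)
    show "dom (cuts s) = terminals P" by (rule dom)
    fix i assume i: "i \<in> terminals P"
    show "loc P i \<in> the (cuts s i)" by (rule cut(1)[OF i])
    have "is_cut P (outermost F' i)"
      using cuts_ofD(2)[OF fam' order.refl outermost_greatest(1)[OF fam' order.refl i]] .
    then show "is_cut P (the (cuts s i))" using cut[OF i] by (auto simp: is_cut_def)
  next
    fix a i j assume a: "a \<in> {1..ncomm P}" "i \<in> comm P a" "j \<in> comm P a" "i \<noteq> j"
    then have ij: "i \<in> terminals P" "j \<in> terminals P" by (auto simp: terminals_def)
    have "loc P j \<notin> \<Union>(cuts_of F i) \<or> loc P i \<notin> \<Union>(cuts_of F j)"
      using F a by (auto simp: frac_feasible_def)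
    then show "loc P j \<notin> the (cuts s i) \<or> loc P i \<notin> the (cuts s j)"
      using union[OF ij(1)] union[OF ij(2)] by blast
  next
    fix e assume e: "e \<in> edges P"
    show "int_load P (cuts s) e \<le> cap P e + 3"
    proof (cases "\<exists>v. e \<subseteq> meta s v")
      case True
      then show ?thesis using settled[OF e] by blast
    next
      case False
      then show ?thesis using active[OF e] by fastforce
    qed
  qed
qed

lemma selectable_exists:
  assumes "todo s \<subseteq> terminals P" "todo s \<noteq> {}"
  shows "\<exists>i. selectable P tie s i"
proof -
  let ?d = "\<lambda>j. depth (fam s) (loc P j)"
  let ?T1 = "{j \<in> todo s. \<forall>k\<in>todo s. ?d k \<le> ?d j}"
  have fin: "finite (todo s)" using assms(1) finite_terminals by (rule finite_subset)
  have "Max (?d ` todo s) \<in> ?d ` todo s" using fin assms(2) by simp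
  then obtain j where "j \<in> todo s" "Max (?d ` todo s) = ?d j" by auto
  moreover have "?d k \<le> Max (?d ` todo s)" if "k \<in> todo s" for k using fin that by simp
  ultimately have nonempty: "?T1 \<noteq> {}" by auto
  have order: "asymp_on ?T1 (dominates (fam s) tie)" "transp_on ?T1 (dominates (fam s) tie)"
    unfolding dominates_eq_prec asymp_on_def transp_on_def using prec_trans prec_irrefl by blast+
  have "finite ?T1" using fin by simp
  from Finite_Set.bex_min_element[OF this order nonempty]
  obtain i where i: "i \<in> ?T1" "\<forall>j\<in>?T1. j \<noteq> i \<longrightarrow> \<not> dominates (fam s) tie j i"
    by meson
  have "\<not> dominates (fam s) tie j i" if "j \<in> ?T1" for j
    using i(2) that by (cases "j = i") (simp_all add: dominates_eq_prec prec_irrefl)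
  then show ?thesis using i(1) unfolding selectable_def Let_def by blast
qed

text \<open>\<open>Error\<close> does not occur since the invariant excludes aborting.\<close>

lemma reachable_cases:
  assumes F: "frac_feasible P (cap P) F" and "(round2_step P tie)\<^sup>*\<^sup>* (Input F) x"
  shows "x = Input F \<or>
    (\<exists>F' s h. preprocessed P tie F F' \<and> loop_invariant P tie s h (outermost F') \<and>
      (x = Loop s \<or> todo s = {} \<and> x = Output (cuts s)))"
  using assms(2)
proof induction
  case (step x y)
  from step.hyps(2) show ?case
  proof cases
    case (start F0 F')
    then have "F0 = F" using step.IH by auto
    then show ?thesis using start invariant_initial[OF F] by blast
  next
    case (error s i)
    then obtain F' h where "loop_invariant P tie s h (outermost F')" using step.IH by blast
    then show ?thesis using error loop_invariant.no_abort by metis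
  next
    case (iteration s i A)
    then obtain F' h where "preprocessed P tie F F'" "loop_invariant P tie s h (outermost F')"
      using step.IH by blast
    then show ?thesis using iteration loop_invariant.invariant_iterate by metis
  next
    case (finish s)
    then show ?thesis using step.IH by blast
  qed
qed simp

lemma no_infinite_run:
  assumes F: "frac_feasible P (cap P) F"
    and g: "g 0 = Input F" "\<And>n::nat. round2_step P tie (g n) (g (Suc n))"
  shows False
proof -
  \<comment> \<open>The offsets make the steps entering and leaving the loop decrease the measure as
    well.\<close>
  define m where "m x = (case x of Input _ \<Rightarrow> card (terminals P) + 2 | Loop s \<Rightarrow> card (todo s) + 1 | _ \<Rightarrow> 0)"
    for x :: "('v, 't) config"
  have "m y < m x" if "(round2_step P tie)\<^sup>*\<^sup>* (Input F) x" "round2_step P tie x y" for x y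
    using that(2)
  proof cases
    case (iteration s i A)
    then have "todo s \<subseteq> terminals P"
      using reachable_cases[OF F that(1)] loop_invariant.todo by blast
    then have "finite (todo s)" using finite_terminals by (rule finite_subset)
    moreover have "i \<in> todo s" using iteration(3) by (simp add: selectable_def Let_def)
    ultimately have "card (todo s - {i}) < card (todo s)" by (rule card_Diff1_less)
    then show ?thesis using iteration by (simp add: m_def iterate_def Let_def)
  qed (simp_all add: m_def initial_def)
  moreover have "(round2_step P tie)\<^sup>*\<^sup>* (Input F) (g n)" for n
    by (induction n) (use g in \<open>auto intro: rtranclp.rtrancl_into_rtrancl\<close>)
  ultimately have "m (g (Suc n)) < m (g n)" for n using g(2) by blast
  then have "m (g n) + n \<le> m (g 0)" for n
    by (induction n) (auto, metis Suc_leI add_Suc_right add_Suc le_trans add_le_mono1)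
  from this[of "Suc (m (g 0))"] show False by simp
qed

end

theorem lemma4:
  fixes P :: "('v, 't) mcp"
    and F :: "('v, 't) family"
    and tie :: "'t rel"
  assumes "mcp_instance P"
    and "frac_feasible P (cap P) F"
    and "strict_linear_order_on (terminals P) tie"
  shows "round2_produces P tie F (int_feasible P (\<lambda>e. cap P e + 3))"
proof -
  interpret round2 P tie using assms(1,3) by unfold_locales
  \<comment> \<open>Only outputs are stuck: the input can be preprocessed, and a loop state either
    finishes or selects a terminal, which does not abort and has a cut to choose.\<close>
  have "\<exists>A. x = Output A \<and> int_feasible P (\<lambda>e. cap P e + 3) A"
    if x: "(round2_step P tie)\<^sup>*\<^sup>* (Input F) x" and stuck: "\<And>y. \<not> round2_step P tie x y" for x
  proof (cases "x = Input F")
    case True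
    then show ?thesis
      using stuck preprocessed_exists assms(2) round2_step.start by (metis frac_feasible_def)
  next
    case False
    then obtain F' s h where inv: "preprocessed P tie F F'" "loop_invariant P tie s h (outermost F')"
      "x = Loop s \<or> todo s = {} \<and> x = Output (cuts s)"
      using reachable_cases[OF assms(2) x] by blast
    have "x \<noteq> Loop s"
    proof
      assume s: "x = Loop s"
      show False
      proof (cases "todo s = {}")
        case True
        then show False using stuck s round2_step.finish by blast
      next
        case False
        then obtain i where i: "selectable P tie s i"
          using selectable_exists loop_invariant.todo[OF inv(2)] by blast
        then obtain A where "chosen_cut P s i A"
          using loop_invariant.chosen_cut_exists[OF inv(2)] by blast
        then show False
          using round2_step.iteration[OF i loop_invariant.no_abort[OF inv(2) i]] stuck s by metis
      qed
    qed
    then have "x = Output (cuts s)" "todo s = {}" using inv(3) by auto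
    then show ?thesis using feasible_output[OF assms(2) inv(1,2)] by simp
  qed
  then show ?thesis
    unfolding round2_produces_def using no_infinite_run[OF assms(2)] by blast
qed

end
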